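(* Let $n\ge1$. If $z\in\mathcal{I}_n$, or if $n$ is even and $z\in\mathcal{I}^{\mathsf{FPF}}_n$, then \[ \widehat{\mathfrak{G}}_z = \sum_{D \in \mathsf{InvDreams}(z)} \beta^{|D| -\widehat\ell(z)} \prod_{(i,j) \in D} x_{i\oplus j}, \] where $x_{i\oplus i}:=x_i$ for $i>0$ and $x_{i\oplus j}:=x_i+x_j+\beta x_ix_j$ for $i>j>0$.
   Context: Let $x_1,x_2,\dots$ be commuting indeterminates and $\beta$ an indeterminate. Let $S_n=\langle s_1,\dots,s_{n-1}\rangle$, $s_i=(i,i+1)$. Let $\mathcal{I}_n=\{w\in S_n:w=w^{-1}\}$ and $\mathcal{I}^{\mathsf{FPF}}_n=\{w^{-1}1^{\mathsf{FPF}}w:w\in S_n\}$, where $1^{\mathsf{FPF}}$ is the permutation of $\mathbb{Z}$ with $i\mapsto i-(-1)^i$. Let $\mathsf{IdCox}$ be the algebra over $\mathbb{Z}[\beta]$ with basis $\pi_w$ ($w\in S_n$), $\pi_v\pi_w=\pi_{vw}$ if $\ell(vw)=\ell(v)+\ell(w)$, $\pi_i^2=\beta\pi_i$ where $\pi_i=\pi_{s_i}$. Let $\mathsf{InvolMod}$ (resp. $\mathsf{FixedMod}$) be the free $\mathbb{Z}[\beta]$-module with basis $m_z$, $z\in\mathcal{I}_n$ (resp. $\mathcal{I}^{\mathsf{FPF}}_n$), a right $\mathsf{IdCox}$-module via: for $z\in\mathcal{I}_n$, $m_z\pi_i=m_{zs_i}$ if $z(i)<z(i+1)$ and $zs_i=s_iz$;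 $m_{s_izs_i}$ if $z(i)<z(i+1)$ and $zs_i\ne s_iz$; $\beta m_z$ if $z(i)>z(i+1)$. For $z\in\mathcal{I}^{\mathsf{FPF}}_n$: $m_z\pi_i=m_{s_izs_i}$ if $z(i)<z(i+1)$; $\beta m_z$ if $i+1\ne z(i)>z(i+1)\ne i$; $0$ if $z(i)=i+1,z(i+1)=i$. An involution Hecke word for $z\in\mathcal{I}_n$ (resp. $z\in\mathcal{I}^{\mathsf{FPF}}_n$) is a word $a_1\cdots a_p$ with letters in $\{1,\dots,n-1\}$ such that $m_1\pi_{a_1}\cdots\pi_{a_p}=\beta^Nm_z$ (resp. $m_{1^{\mathsf{FPF}}}\pi_{a_1}\cdots\pi_{a_p}=\beta^Nm_z$) for some integer $N\ge0$; $\mathsf{InvHecke}(z)$ is the set of these, and $\widehat\ell(z)=\min\{\ell(a):a\in\mathsf{InvHecke}(z)\}$. For a word $a=a_1\cdots a_p$, a bounded compatible sequence is a weakly increasing integer sequence $\mathbf{i}=(i_1\le\dots\le i_p)$ with $i_j<i_{j+1}$ whenever $a_j\le a_{j+1}$ and $i_j\le a_j$ whenever $0<i_j$; $\mathsf{Compatible}(a)$ is their set, $\ell(\mathbf{i})=p$, $x_{\mathbf{i}}=x_{i_1}\cdots x_{i_p}$, and $0<\mathbf{i}$ means all $i_j$ positive. The involution Grothendieck polynomial is $\widehat{\mathfrak{G}}_z=\sum_{a\in\mathsf{InvHecke}(z)}\sum_{0<\mathbf{i}\in\mathsf{Compatible}(a)}\beta^{\ell(\mathbf{i})-\widehat\ell(z)}x_{\mathbf{i}}$.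 Totally order $\{(i,j)\in\mathbb{Z}^2:i\ge j>0\}$ by $(i,j)\prec(k,l)$ iff $i<k$, or $i=k$ and $j>l$. An involution Hecke pipe dream for $z\in\mathcal{I}_n$ (resp. $z\in\mathcal{I}^{\mathsf{FPF}}_n$) is a finite subset $D$ of $\{(i,j):i\ge j>0\}$ (resp. of $\{(i,j):i>j>0\}$) such that the word formed by listing $i+j-1$ as $(i,j)$ runs over $D$ in $\prec$-increasing order lies in $\mathsf{InvHecke}(z)$; $\mathsf{InvDreams}(z)$ is the set of these. *)

theory Defs
  imports "HOL-Library.Poly_Mapping" "HOL-Computational_Algebra.Polynomial"
    "HOL-Combinatorics.Permutations"
begin

text \<open>
  The coefficient ring \<open>\<int>[\<beta>]\<close> is \<^typ>\<open>int poly\<close>, with \<open>\<beta>\<close> its variable. The polynomial ring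
  \<open>\<int>[\<beta>][x\<^sub>1, x\<^sub>2, \<dots>]\<close> is the monoid ring of finitely supported exponent vectors; the
  variable with index \<open>0\<close> exists in the type but never occurs below.
\<close>

type_synonym gpoly = "(nat \<Rightarrow>\<^sub>0 nat) \<Rightarrow>\<^sub>0 int poly"

definition beta :: "int poly" where
  "beta = [:0, 1:]"

definition Beta :: gpoly where
  "Beta = Poly_Mapping.single 0 beta"

definition Xvar :: "nat \<Rightarrow> gpoly" where
  "Xvar i = Poly_Mapping.single (Poly_Mapping.single i 1) 1"


text \<open>
  All permutations are permutations of \<open>\<int>\<close>; \<open>S\<^sub>n\<close> consists of those supported on \<open>{1..n}\<close>.
  Products of permutations are compositions, so \<open>(z s\<^sub>i)(k) = z(s\<^sub>i(k))\<close>.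
\<close>

type_synonym perm = "int \<Rightarrow> int"

definition Sym :: "nat \<Rightarrow> perm set" where
  "Sym n = {w. w permutes {1..int n}}"

definition sref :: "nat \<Rightarrow> perm" where
  "sref i = transpose (int i) (int i + 1)"

definition one_fpf :: perm where
  "one_fpf i = i - (if even i then 1 else - 1)"

definition Invol :: "nat \<Rightarrow> perm set" where
  "Invol n = {w \<in> Sym n. w = inv w}"

definition Invol_fpf :: "nat \<Rightarrow> perm set" where
  "Invol_fpf n = {inv w \<circ> one_fpf \<circ> w | w. w \<in> Sym n}"


text \<open>
  Elements of the free \<open>\<int>[\<beta>]\<close>-modules with bases indexed by \<^term>\<open>Invol n\<close> and
  \<^term>\<open>Invol_fpf n\<close> are represented as finitely supported functions on all of \<^typ>\<open>perm\<close>;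
  the two modules are the submodules of functions supported on the respective index set
  (these are stable under the generators, see below).
\<close>

type_synonym pmod = "perm \<Rightarrow>\<^sub>0 int poly"

definition scale :: "int poly \<Rightarrow> pmod \<Rightarrow> pmod" where
  "scale c v = Poly_Mapping.map ((*) c) v"

definition mbasis :: "perm \<Rightarrow> pmod" where
  "mbasis z = Poly_Mapping.single z 1"

definition lin_ext :: "(perm \<Rightarrow> pmod) \<Rightarrow> pmod \<Rightarrow> pmod" where
  "lin_ext g v = (\<Sum>z\<in>Poly_Mapping.keys v. scale (Poly_Mapping.lookup v z) (g z))"

definition InvolMod :: "nat \<Rightarrow> pmod set" where
  "InvolMod n = {v. Poly_Mapping.keys v \<subseteq> Invol n}"

definition FixedMod :: "nat \<Rightarrow> pmod set" where
  "FixedMod n = {v. Poly_Mapping.keys v \<subseteq> Invol_fpf n}"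

text \<open>
  Right action of the generator \<open>\<pi>\<^sub>i\<close>, first on basis elements and then extended linearly.
  The permutations \<open>z\<close> are injective, so the outer \<open>else\<close> branches are the case \<open>z(i) > z(i+1)\<close>;
  they are also involutions, so \<open>z(i) = i+1\<close> and \<open>z(i+1) = i\<close> are equivalent.
\<close>

definition invol_basis_act :: "nat \<Rightarrow> perm \<Rightarrow> pmod" where
  "invol_basis_act i z =
     (if z (int i) < z (int i + 1)
      then (if z \<circ> sref i = sref i \<circ> z then mbasis (z \<circ> sref i) else mbasis (sref i \<circ> z \<circ> sref i))
      else scale beta (mbasis z))"

definition fixed_basis_act :: "nat \<Rightarrow> perm \<Rightarrow> pmod" where
  "fixed_basis_act i z =
     (if z (int i) < z (int i + 1) then mbasis (sref i \<circ> z \<circ> sref i)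
      else if z (int i) = int i + 1 \<and> z (int i + 1) = int i then 0
      else scale beta (mbasis z))"

definition invol_act :: "pmod \<Rightarrow> nat \<Rightarrow> pmod" where
  "invol_act v i = lin_ext (invol_basis_act i) v"

definition fixed_act :: "pmod \<Rightarrow> nat \<Rightarrow> pmod" where
  "fixed_act v i = lin_ext (fixed_basis_act i) v"

text \<open>
  Since \<^term>\<open>Invol n\<close> and \<^term>\<open>Invol_fpf n\<close> are disjoint (lemma \<open>Invol_disjoint\<close>), the following
  notions can be defined for both kinds of \<open>z\<close> at once. A product \<open>\<pi>\<^bsub>a\<^sub>1\<^esub> \<cdots> \<pi>\<^bsub>a\<^sub>p\<^esub>\<close> acts through its
  generators, one after the other from left to right.
\<close>

definition InvHecke :: "nat \<Rightarrow> perm \<Rightarrow> nat list set" where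
  "InvHecke n z = {a. set a \<subseteq> {1..n - 1} \<and>
     (z \<in> Invol n \<and> (\<exists>N. foldl invol_act (mbasis id) a = scale (beta ^ N) (mbasis z)) \<or>
      z \<in> Invol_fpf n \<and> (\<exists>N. foldl fixed_act (mbasis one_fpf) a = scale (beta ^ N) (mbasis z)))}"

definition inv_len :: "nat \<Rightarrow> perm \<Rightarrow> nat" where
  "inv_len n z = (LEAST k. \<exists>a \<in> InvHecke n z. k = length a)"

definition Compatible :: "nat list \<Rightarrow> int list set" where
  "Compatible a = {is. length is = length a \<and> sorted is \<and>
     (\<forall>j. Suc j < length a \<longrightarrow> a ! j \<le> a ! Suc j \<longrightarrow> is ! j < is ! Suc j) \<and>
     (\<forall>j < length a. 0 < is ! j \<longrightarrow> is ! j \<le> int (a ! j))}"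

text \<open>
  There are infinitely many Hecke words, but only finitely many pairs \<open>(a, is)\<close> as below
  (lemma \<open>finite_compatible_pairs\<close>), so the double sum is a finite sum over such pairs.
  The exponents of \<open>\<beta>\<close>, here and for pipe dreams, are differences of natural numbers that
  never truncate, by minimality of \<^term>\<open>inv_len n z\<close>.
\<close>

definition compatible_pairs :: "nat \<Rightarrow> perm \<Rightarrow> (nat list \<times> int list) set" where
  "compatible_pairs n z = (SIGMA a : InvHecke n z. {is \<in> Compatible a. \<forall>i \<in> set is. 0 < i})"

definition inv_groth :: "nat \<Rightarrow> perm \<Rightarrow> gpoly" where
  "inv_groth n z = (\<Sum>(a, is) \<in> compatible_pairs n z.
     Beta ^ (length is - inv_len n z) * (\<Prod>i\<leftarrow>is. Xvar (nat i)))"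

definition prec :: "nat \<times> nat \<Rightarrow> nat \<times> nat \<Rightarrow> bool" where
  "prec p q \<longleftrightarrow> fst p < fst q \<or> fst p = fst q \<and> snd p > snd q"

definition dream_word :: "(nat \<times> nat) set \<Rightarrow> nat list" where
  "dream_word D = map (\<lambda>(i, j). i + j - 1) (THE ps. sorted_wrt prec ps \<and> set ps = D)"

definition InvDreams :: "nat \<Rightarrow> perm \<Rightarrow> (nat \<times> nat) set set" where
  "InvDreams n z = {D. finite D \<and>
     (z \<in> Invol n \<and> D \<subseteq> {(i, j). i \<ge> j \<and> j > 0} \<or>
      z \<in> Invol_fpf n \<and> D \<subseteq> {(i, j). i > j \<and> j > 0}) \<and>
     dream_word D \<in> InvHecke n z}"

definition x_oplus :: "nat \<Rightarrow> nat \<Rightarrow> gpoly" where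
  "x_oplus i j = (if i = j then Xvar i else Xvar i + Xvar j + Beta * Xvar i * Xvar j)"


lemma Invol_disjoint: "Invol n \<inter> Invol_fpf n = {}"
proof -
  have False if "z \<in> Invol n" "z \<in> Invol_fpf n" for z
  proof -
    from that(2) obtain w where w: "w permutes {1..int n}" and z: "z = inv w \<circ> one_fpf \<circ> w"
      by (auto simp: Invol_fpf_def Sym_def)
    from that(1) have "z 0 = 0"
      by (auto simp: Invol_def Sym_def permutes_def)
    moreover have "w 0 = 0" using w by (auto simp: permutes_def)
    ultimately have "inv w (one_fpf 0) = 0" by (simp add: z)
    then have "one_fpf 0 = w 0" using w by (metis permutes_inverses(1))
    with \<open>w 0 = 0\<close> show False by (simp add: one_fpf_def)
  qed
  then show ?thesis by blast
qed

lemma keys_scale: "Poly_Mapping.keys (scale c v) \<subseteq> Poly_Mapping.keys v"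
  by (auto simp: scale_def in_keys_iff Poly_Mapping.map.rep_eq when_def)

lemma keys_lin_ext:
  assumes "\<And>z. z \<in> Poly_Mapping.keys v \<Longrightarrow> Poly_Mapping.keys (g z) \<subseteq> A"
  shows "Poly_Mapping.keys (lin_ext g v) \<subseteq> A"
proof -
  have "Poly_Mapping.keys (lin_ext g v) \<subseteq>
      (\<Union>z\<in>Poly_Mapping.keys v. Poly_Mapping.keys (scale (Poly_Mapping.lookup v z) (g z)))"
    unfolding lin_ext_def by (rule Poly_Mapping.keys_sum)
  also have "\<dots> \<subseteq> A" using assms keys_scale by blast
  finally show ?thesis .
qed

lemma sref_Sym: "i \<in> {1..n - 1} \<Longrightarrow> sref i \<in> Sym n"
  unfolding sref_def Sym_def by (auto intro!: permutes_swap_id)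

lemma sref_sref [simp]: "sref i \<circ> sref i = id"
  by (simp add: sref_def)

lemma Invol_iff: "z \<in> Invol n \<longleftrightarrow> z \<in> Sym n \<and> z \<circ> z = id"
proof -
  have "z = inv z \<longleftrightarrow> z \<circ> z = id" if "z \<in> Sym n"
    using that unfolding Sym_def
    by (metis inv_unique_comp mem_Collect_eq permutes_inv_o(1))
  then show ?thesis by (auto simp: Invol_def)
qed

lemma invol_act_closed:
  assumes "v \<in> InvolMod n" "i \<in> {1..n - 1}"
  shows "invol_act v i \<in> InvolMod n"
proof -
  have "Poly_Mapping.keys (invol_basis_act i z) \<subseteq> Invol n" if z: "z \<in> Invol n" for z
  proof -
    have zS: "z \<in> Sym n" and zz: "z \<circ> z = id" using z by (auto simp: Invol_iff)
    have sz: "sref i (sref i k) = k" "z (z k) = k" for k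
      using sref_sref[of i] zz by (metis comp_apply id_apply)+
    have "sref i \<circ> z \<circ> sref i \<in> Sym n" "z \<circ> sref i \<in> Sym n"
      using zS sref_Sym[OF assms(2)] by (auto simp: Sym_def intro!: permutes_compose)
    moreover have "(sref i \<circ> z \<circ> sref i) \<circ> (sref i \<circ> z \<circ> sref i) = id"
      by (auto simp: fun_eq_iff sz)
    moreover have "(z \<circ> sref i) \<circ> (z \<circ> sref i) = id" if "z \<circ> sref i = sref i \<circ> z"
      using that by (auto simp: fun_eq_iff sz)
    ultimately show ?thesis
      using z keys_scale[of beta "mbasis z"]
      by (auto simp: invol_basis_act_def mbasis_def Invol_iff split: if_splits)
  qed
  then show ?thesis
    using assms(1) unfolding InvolMod_def invol_act_def
    by (simp add: keys_lin_ext subset_iff[of "Poly_Mapping.keys v"])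
qed

lemma fixed_act_closed:
  assumes "v \<in> FixedMod n" "i \<in> {1..n - 1}"
  shows "fixed_act v i \<in> FixedMod n"
proof -
  have "Poly_Mapping.keys (fixed_basis_act i z) \<subseteq> Invol_fpf n" if z: "z \<in> Invol_fpf n" for z
  proof -
    from z obtain w where w: "w \<in> Sym n" "z = inv w \<circ> one_fpf \<circ> w"
      by (auto simp: Invol_fpf_def)
    have ws: "w \<circ> sref i \<in> Sym n"
      using w sref_Sym[OF assms(2)] by (auto simp: Sym_def intro!: permutes_compose)
    have "bij w" "bij (sref i)"
      using w sref_Sym[OF assms(2)] by (auto simp: Sym_def permutes_bij)
    then have "inv (w \<circ> sref i) = sref i \<circ> inv w"
      by (simp add: o_inv_distrib sref_def)
    then have "sref i \<circ> z \<circ> sref i = inv (w \<circ> sref i) \<circ> one_fpf \<circ> (w \<circ> sref i)"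
      by (simp add: w o_assoc)
    then have "sref i \<circ> z \<circ> sref i \<in> Invol_fpf n" using ws by (auto simp: Invol_fpf_def)
    then show ?thesis
      using z keys_scale[of beta "mbasis z"]
      by (auto simp: fixed_basis_act_def mbasis_def split: if_splits)
  qed
  then show ?thesis
    using assms(1) unfolding FixedMod_def fixed_act_def
    by (simp add: keys_lin_ext subset_iff[of "Poly_Mapping.keys v"])
qed

lemma ex1_prec_list:
  assumes "finite D"
  shows "\<exists>!ps. sorted_wrt prec ps \<and> set ps = D"
proof -
  have tot: "prec p q \<or> p = q \<or> prec q p" for p q
    by (auto simp: prec_def prod_eq_iff)
  have tr: "prec p q \<Longrightarrow> prec q r \<Longrightarrow> prec p r" for p q r
    by (auto simp: prec_def)
  have irr: "\<not> prec p p" for p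
    by (auto simp: prec_def)
  have "\<exists>ps. sorted_wrt prec ps \<and> set ps = D"
    using assms
  proof (induction D)
    case empty
    then show ?case by (auto intro: exI[of _ "[]"])
  next
    case (insert p D)
    then obtain ps where ps: "sorted_wrt prec ps" "set ps = D" by blast
    let ?qs = "filter (\<lambda>q. prec q p) ps @ p # filter (\<lambda>q. prec p q) ps"
    have "sorted_wrt prec ?qs"
      using ps by (auto simp: sorted_wrt_append sorted_wrt_filter intro: tr)
    moreover have "set ?qs = insert p D"
      using ps insert.hyps tot[of p] by auto
    ultimately show ?case by blast
  qed
  moreover have "ps = qs"
    if "sorted_wrt prec ps" "sorted_wrt prec qs" "set ps = set qs" for ps qs
    using that
  proof (induction ps arbitrary: qs)
    case Nil
    then show ?case by simp
  next
    case (Cons p ps)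
    then obtain q qs' where q: "qs = q # qs'" by (cases qs) auto
    have pq: "p = q" using Cons.prems q irr tr
      by (metis list.set_intros(1) set_ConsD sorted_wrt.simps(2))
    have "p \<notin> set ps" "q \<notin> set qs'" using Cons.prems q irr by (metis sorted_wrt.simps(2))+
    then have "set ps = set qs'" using Cons.prems q pq by auto
    then show ?case using Cons q pq by auto
  qed
  ultimately show ?thesis by blast
qed

lemma finite_compatible_pairs: "finite (compatible_pairs n z)"
proof -
  have len: "length a \<le> n * n"
    if a: "set a \<subseteq> {1..n - 1}" and "is \<in> Compatible a" "\<forall>i \<in> set is. 0 < i" for a "is"
  proof -
    let ?L = "length a"
    have le: "length is = ?L" "sorted is"
      and strict: "\<And>j. Suc j < ?L \<Longrightarrow> a ! j \<le> a ! Suc j \<Longrightarrow> is ! j < is ! Suc j"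
      and bd: "\<And>j. j < ?L \<Longrightarrow> 0 < is ! j \<and> is ! j \<le> int (a ! j)"
      using that by (auto simp: Compatible_def)
    have ab: "1 \<le> a ! j \<and> a ! j \<le> n - 1" if "j < ?L" for j
      using a that by (meson atLeastAtMost_iff nth_mem subsetD)
    define f where "f j = is ! j * int n + (int n - int (a ! j))" for j
    have step: "f j < f (Suc j)" if j: "Suc j < ?L" for j
    proof (cases "a ! j \<le> a ! Suc j")
      case True
      then have "is ! j + 1 \<le> is ! Suc j" using strict j by force
      then have "(is ! j + 1) * int n \<le> is ! Suc j * int n"
        by (intro mult_right_mono) auto
      moreover have "int (a ! Suc j) < int n + int (a ! j)" using ab[of j] ab[of "Suc j"] j by auto
      ultimately show ?thesis by (simp add: f_def algebra_simps)
    next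
      case False
      have "is ! j \<le> is ! Suc j" using le j by (simp add: sorted_nth_mono)
      then have "is ! j * int n \<le> is ! Suc j * int n"
        by (intro mult_right_mono) auto
      then show ?thesis using False by (simp add: f_def)
    qed
    have lb: "int n + int j < f j" if "j < ?L" for j
      using that
    proof (induction j)
      case 0
      have "1 * int n \<le> is ! 0 * int n" using bd[of 0] 0 by (intro mult_right_mono) auto
      then show ?case using ab[of 0] 0 unfolding f_def by linarith
    next
      case (Suc j)
      then show ?case using step[of j] by simp
    qed
    show ?thesis
    proof (cases "?L = 0")
      case False
      define j where "j = ?L - 1"
      have j: "j < ?L" "?L = Suc j" using False by (auto simp: j_def)
      have "is ! j \<le> int n - 1" using bd[OF j(1)] ab[OF j(1)] by auto
      then have "is ! j * int n \<le> (int n - 1) * int n" by (intro mult_right_mono) auto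
      with lb[OF j(1)] ab[OF j(1)] have "int ?L \<le> int (n * n)"
        by (simp add: f_def j(2) algebra_simps)
      then show ?thesis by linarith
    qed auto
  qed
  let ?W = "{a. set a \<subseteq> {1..n - 1} \<and> length a \<le> n * n}"
  let ?I = "{b. set b \<subseteq> {0..int n} \<and> length b \<le> n * n}"
  have "compatible_pairs n z \<subseteq> ?W \<times> ?I"
  proof (clarsimp simp: compatible_pairs_def)
    fix a "is"
    assume a: "a \<in> InvHecke n z" and c: "is \<in> Compatible a" and p: "\<forall>i\<in>set is. 0 < i"
    have sa: "set a \<subseteq> {1..n - 1}" using a by (simp add: InvHecke_def)
    have "set is \<subseteq> {0..int n}"
    proof
      fix i assume "i \<in> set is"
      then obtain j where j: "j < length a" "i = is ! j"
        using c by (auto simp: Compatible_def in_set_conv_nth)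
      then have "0 < i" "i \<le> int (a ! j)"
        using c p \<open>i \<in> set is\<close> by (auto simp: Compatible_def)
      moreover have "a ! j \<le> n - 1" using sa j by (meson atLeastAtMost_iff nth_mem subsetD)
      ultimately show "i \<in> {0..int n}" by auto
    qed
    moreover have "length is = length a" using c by (simp add: Compatible_def)
    ultimately show "set a \<subseteq> {Suc 0..n - Suc 0} \<and> length a \<le> n * n \<and>
        set is \<subseteq> {0..int n} \<and> length is \<le> n * n"
      using sa len[OF sa c p] by simp
  qed
  moreover have "finite (?W \<times> ?I)"
    by (intro finite_cartesian_product finite_lists_length_le) auto
  ultimately show ?thesis by (rule finite_subset)
qed

lemma finite_InvDreams: "finite (InvDreams n z)"
proof -
  have "InvDreams n z \<subseteq> Pow ({0..n} \<times> {0..n})"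
  proof clarify
    fix D i j
    assume D: "D \<in> InvDreams n z" and ij: "(i, j) \<in> D"
    then have fin: "finite D" and w: "set (dream_word D) \<subseteq> {1..n - 1}" and "i \<ge> j" "j > 0"
      by (auto simp: InvDreams_def InvHecke_def)
    have "set (THE ps. sorted_wrt prec ps \<and> set ps = D) = D"
      using theI'[OF ex1_prec_list[OF fin]] by blast
    then have "i + j - 1 \<in> set (dream_word D)"
      using ij by (force simp: dream_word_def)
    then have "i + j - 1 \<le> n - 1" using w by auto
    then show "i \<in> {0..n} \<and> j \<in> {0..n}" using \<open>i \<ge> j\<close> \<open>j > 0\<close> by auto
  qed
  then show ?thesis by (rule finite_subset) auto
qed

end

theory Submission
  imports Defs
begin

text \<open>
  Let \<open>h\<^sub>i(x) = 1 + x \<pi>\<^sub>i\<close>. Then \<open>h\<^sub>i(x) h\<^sub>i(y) = h\<^sub>i(x \<oplus> y)\<close>, and the \<open>h\<^sub>i\<close> satisfy the Yang--Baxter equation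
  \<open>h\<^sub>i(x) h\<^sub>i\<^sub>+\<^sub>1(x \<oplus> y) h\<^sub>i(y) = h\<^sub>i\<^sub>+\<^sub>1(y) h\<^sub>i(x \<oplus> y) h\<^sub>i\<^sub>+\<^sub>1(x)\<close>. The Grothendieck polynomials are the
  coefficients of \<open>m A\<^sub>1(x\<^sub>1) A\<^sub>2(x\<^sub>2) \<cdots>\<close>, where \<open>m\<close> is the base point of the module and
  \<open>A\<^sub>i(x) = h\<^sub>n\<^sub>-\<^sub>1(x) \<cdots> h\<^sub>i(x)\<close>, while the pipe dream sums are the coefficients of
  \<open>m R\<^sub>1 R\<^sub>2 \<cdots>\<close> with \<open>R\<^sub>k = h\<^sub>2\<^sub>k\<^sub>-\<^sub>1(x\<^sub>k) h\<^sub>2\<^sub>k\<^sub>-\<^sub>2(x\<^sub>k \<oplus> x\<^sub>k\<^sub>-\<^sub>1) \<cdots> h\<^sub>k(x\<^sub>k \<oplus> x\<^sub>1)\<close>, without the first factor in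
  the fixed-point-free case. With \<open>B\<^sub>i(x) = h\<^sub>i(x) \<cdots> h\<^sub>n\<^sub>-\<^sub>1(x)\<close>, the Yang--Baxter equation gives
  \<open>B\<^sub>i(x) A\<^sub>i(y) = A\<^sub>i\<^sub>+\<^sub>1(y) h\<^sub>i(x \<oplus> y) B\<^sub>i\<^sub>+\<^sub>1(x)\<close>. The special relations at the base point,
  \<open>m \<pi>\<^sub>i \<pi>\<^sub>i\<^sub>+\<^sub>1 = m \<pi>\<^sub>i\<^sub>+\<^sub>1 \<pi>\<^sub>i\<close> for involutions, and \<open>m \<pi>\<^sub>i = 0\<close> for odd \<open>i\<close> together with
  \<open>m \<pi>\<^sub>2\<^sub>j \<pi>\<^sub>2\<^sub>j\<^sub>-\<^sub>1 = m \<pi>\<^sub>2\<^sub>j \<pi>\<^sub>2\<^sub>j\<^sub>+\<^sub>1\<close> in the fixed-point-free case, give \<open>m A\<^sub>i(y) = m B\<^sub>i(y)\<close>, respectively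
  \<open>m A\<^sub>2\<^sub>k\<^sub>+\<^sub>1(y) = m B\<^sub>2\<^sub>k\<^sub>+\<^sub>2(y)\<close>. Applying these in turn transforms one product into the other.
\<close>

section \<open>The action on basis elements\<close>

text \<open>
  Both modules move basis elements in the same way, by Demazure conjugation \<open>z \<mapsto> s\<^sub>i * z * s\<^sub>i\<close>;
  only the coefficients differ, and only in that \<open>\<pi>\<^sub>i\<close> kills \<open>m\<^sub>z\<close> with \<open>z(i) = i + 1\<close> in the
  fixed-point-free module. The flag \<open>fpf\<close> selects the module.
\<close>

definition act :: "nat \<Rightarrow> perm \<Rightarrow> perm" where
  "act i z = (if z (int i) < z (int i + 1)
     then if z (int i) = int i \<and> z (int i + 1) = int i + 1 then z \<circ> sref i else sref i \<circ> z \<circ> sref i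
     else z)"

definition act_coeff :: "bool \<Rightarrow> nat \<Rightarrow> perm \<Rightarrow> int poly" where
  "act_coeff fpf i z = (if z (int i) < z (int i + 1) then 1
     else if fpf \<and> z (int i) = int i + 1 then 0 else beta)"

text \<open>No support condition is imposed, since \<open>one_fpf\<close> moves every
  integer.\<close>

definition involutions :: "bool \<Rightarrow> perm set" where
  "involutions fpf = {z. z \<circ> z = id \<and> (fpf \<longrightarrow> (\<forall>k. z k \<noteq> k))}"

lemma involutionsD: "z \<in> involutions fpf \<Longrightarrow> z (z k) = k"
  by (auto simp: involutions_def fun_eq_iff)

lemma involutions_eq_iff: "z \<in> involutions fpf \<Longrightarrow> z k = z l \<longleftrightarrow> k = l"
  by (metis involutionsD)

lemma sref_apply: "sref i k = (if k = int i then int i + 1 else if k = int i + 1 then int i else k)"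
  by (auto simp: sref_def transpose_def)

lemma sref_apply_sref [simp]: "sref i (sref i k) = k" by (auto simp: sref_apply)

lemma act_involutions:
  assumes z: "z \<in> involutions fpf"
  shows "act i z \<in> involutions fpf"
proof -
  note zz = involutionsD[OF z]
  have "act i z (act i z k) = k" for k
  proof -
    have e: "z k = int i \<longleftrightarrow> k = z (int i)" "z k = int i + 1 \<longleftrightarrow> k = z (int i + 1)"
      by (metis zz)+
    show ?thesis by (auto simp: act_def zz) (auto simp: sref_apply e zz)
  qed
  moreover have "act i z k \<noteq> k" if fpf for k
  proof -
    have n: "z l \<noteq> l" for l using z that by (simp add: involutions_def)
    have "sref i (z (sref i k)) \<noteq> k" using n by (metis sref_apply_sref)
    then show ?thesis using n by (auto simp: act_def)
  qed
  ultimately show ?thesis by (auto simp: involutions_def fun_eq_iff)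
qed

text \<open>After an ascent, \<open>act i z\<close> has a descent at \<open>i\<close>, and with the
  flag set it does not match \<open>i\<close> with \<open>i + 1\<close>, so the second factor is
  \<open>beta\<close>. At a descent \<open>z\<close> stays put and the coefficient is
  \<open>0\<close> or \<open>beta\<close>.\<close>

lemma act_coeff_quadratic:
  assumes z: "z \<in> involutions fpf"
  shows "act_coeff fpf i z * act_coeff fpf i (act i z) = beta * act_coeff fpf i z" (is ?c)
    and "act i (act i z) = act i z" (is ?n)
proof -
  have n: "z l \<noteq> l" if fpf for l using z that by (simp add: involutions_def)
  note [simp] = involutionsD[OF z] involutions_eq_iff[OF z]
  have "z (int i + 1) = int i \<longleftrightarrow> z (int i) = int i + 1"
    by (metis involutionsD[OF z])
  then show ?c ?n using n[of "int i"]
    by (auto simp: act_coeff_def act_def sref_apply)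
qed

text \<open>
  Right and left multiplication in the 0-Hecke monoid. Since they commute, the relations for
  Demazure conjugation follow from those of right multiplication.
\<close>

definition dem_right :: "nat \<Rightarrow> perm \<Rightarrow> perm" where
  "dem_right i w = (if w (int i) < w (int i + 1) then w \<circ> sref i else w)"

definition dem_left :: "nat \<Rightarrow> perm \<Rightarrow> perm" where
  "dem_left i w = inv (dem_right i (inv w))"

lemma bij_sref [simp]: "bij (sref i)"
  by (simp add: sref_def)

lemma inv_sref [simp]: "inv (sref i) = sref i"
  by (simp add: sref_def)

lemma bij_dem_right [simp]: "bij w \<Longrightarrow> bij (dem_right i w)"
  by (simp add: dem_right_def bij_comp)

lemma bij_dem_left [simp]: "bij w \<Longrightarrow> bij (dem_left i w)"
  by (simp add: dem_left_def bij_imp_bij_inv)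

lemma dem_left_eq:
  assumes "bij w"
  shows "dem_left i w = (if inv w (int i) < inv w (int i + 1) then sref i \<circ> w else w)"
  using assms by (auto simp: dem_left_def dem_right_def o_inv_distrib bij_imp_bij_inv inv_inv_eq)

lemma sref_braid: "sref i (sref (Suc i) (sref i k)) = sref (Suc i) (sref i (sref (Suc i) k))"
  by (auto simp: sref_apply)

lemma dem_right_commute: "Suc i < j \<Longrightarrow> dem_right i (dem_right j w) = dem_right j (dem_right i w)"
  by (auto simp: dem_right_def fun_eq_iff sref_apply)

text \<open>Both sides sort the values at \<open>i\<close>, \<open>i + 1\<close>,
  \<open>i + 2\<close> into decreasing order.\<close>

lemma dem_right_braid:
  assumes "inj w"
  shows "dem_right i (dem_right (Suc i) (dem_right i w)) = dem_right (Suc i) (dem_right i (dem_right (Suc i) w))"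
proof -
  have "w (int i) \<noteq> w (int i + 1)" "w (int i) \<noteq> w (int i + 2)" "w (int i + 1) \<noteq> w (int i + 2)"
    using assms by (auto simp: inj_eq)
  then show ?thesis
    using sref_braid[of i]
    by (auto simp: dem_right_def fun_eq_iff sref_apply add.commute)
qed

lemma dem_left_commute:
  "bij w \<Longrightarrow> Suc i < j \<Longrightarrow> dem_left i (dem_left j w) = dem_left j (dem_left i w)"
  by (simp add: dem_left_def inv_inv_eq bij_imp_bij_inv dem_right_commute[of i j])

lemma dem_left_braid:
  "bij w \<Longrightarrow> dem_left i (dem_left (Suc i) (dem_left i w)) = dem_left (Suc i) (dem_left i (dem_left (Suc i) w))"
  by (simp add: dem_left_def inv_inv_eq bij_imp_bij_inv dem_right_braid bij_is_inj)

lemma sref_less_iff: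
  "\<not> (x = int i \<and> y = int i + 1) \<Longrightarrow> \<not> (x = int i + 1 \<and> y = int i) \<Longrightarrow>
    sref i x < sref i y \<longleftrightarrow> x < y"
  by (auto simp: sref_apply)

text \<open>Either operation can change the test of the other only if \<open>w\<close> maps
  \<open>{i, i + 1}\<close> onto \<open>{j, j + 1}\<close>. The two ways of doing so are treated
  separately.\<close>

lemma dem_left_right:
  assumes w: "bij w"
  shows "dem_left j (dem_right i w) = dem_right i (dem_left j w)"
proof -
  have iw: "inv w (w k) = k" "w (inv w k) = k" for k
    using w by (simp_all add: bij_is_inj bij_is_surj surj_f_inv_f)
  have iwe: "inv w k = l \<longleftrightarrow> k = w l" for k l
    using iw by metis
  have inv_ws: "inv (w \<circ> sref i) = sref i \<circ> inv w"
    using w by (simp add: o_inv_distrib)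
  have eq: "w (int i) = x \<and> w (int i + 1) = y \<longleftrightarrow> inv w x = int i \<and> inv w y = int i + 1" for x y
    by (metis iw)
  have L: "dem_left j (w \<circ> sref i) = (if sref i (inv w (int j)) < sref i (inv w (int j + 1))
      then sref j \<circ> w \<circ> sref i else w \<circ> sref i)"
    using w by (simp add: dem_left_eq bij_comp inv_ws o_assoc)
  show ?thesis
  proof (cases "w (int i) = int j \<and> w (int i + 1) = int j + 1")
    \<comment> \<open>The two swaps coincide here, and in either order only the first one is carried
      out.\<close>
    case True
    then have e: "inv w (int j) = int i" "inv w (int j + 1) = int i + 1" using eq by auto
    moreover have "w \<circ> sref i = sref j \<circ> w"
    proof
      fix k show "(w \<circ> sref i) k = (sref j \<circ> w) k"
        using True by (auto simp: sref_apply) (metis iw)+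
    qed
    moreover have "dem_left j (w \<circ> sref i) = w \<circ> sref i"
      unfolding L e by (simp add: sref_apply)
    ultimately show ?thesis
      using True w by (simp add: dem_right_def dem_left_eq) (simp add: sref_apply)
  next
    case F: False
    show ?thesis
    proof (cases "w (int i) = int j + 1 \<and> w (int i + 1) = int j")
      case True
      then have "inv w (int j + 1) = int i" "inv w (int j) = int i + 1" using eq[of "int j + 1" "int j"] by auto
      with True show ?thesis
        using w by (auto simp: dem_right_def dem_left_eq)
    next
      case False
      have "sref j (w (int i)) < sref j (w (int i + 1)) \<longleftrightarrow> w (int i) < w (int i + 1)"
        using F False by (intro sref_less_iff) auto
      moreover have "sref i (inv w (int j)) < sref i (inv w (int j + 1)) \<longleftrightarrow> inv w (int j) < inv w (int j + 1)"
        using F False eq[of "int j" "int j + 1"] eq[of "int j + 1" "int j"] by (intro sref_less_iff) auto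
      ultimately show ?thesis
        using w by (auto simp: dem_right_def dem_left_eq L o_assoc)
    qed
  qed
qed

lemma involutions_inv:
  assumes "z \<in> involutions fpf" shows "inv z = z" "bij z"
  using assms by (auto simp: involutions_def inv_unique_comp o_bij)

text \<open>After an ascending right multiplication the left test fails exactly when
  \<open>z\<close> fixes \<open>i\<close> and \<open>i + 1\<close>. This is the case in which
  \<open>act\<close> multiplies on one side only.\<close>

lemma act_eq_dem:
  assumes z: "z \<in> involutions fpf"
  shows "act i z = dem_left i (dem_right i z)"
proof -
  note [simp] = involutions_inv[OF z]
  have "sref i (z (int i)) < sref i (z (int i + 1)) \<longleftrightarrow> \<not> (z (int i) = int i \<and> z (int i + 1) = int i + 1)"
    if "z (int i) < z (int i + 1)"
  proof (cases "z (int i) = int i \<and> z (int i + 1) = int i + 1")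
    case True then show ?thesis by (simp add: sref_apply)
  next
    case False then show ?thesis using that by (subst sref_less_iff) auto
  qed
  moreover have "inv (z \<circ> sref i) = sref i \<circ> z" by (simp add: o_inv_distrib)
  ultimately show ?thesis
    by (auto simp: act_def dem_right_def dem_left_eq bij_comp o_assoc)
qed

lemma act_commute:
  assumes z: "z \<in> involutions fpf" and ij: "Suc i < j"
  shows "act j (act i z) = act i (act j z)"
proof -
  note [simp] = involutions_inv[OF z]
  have *: "act i (act j z) = dem_left i (dem_left j (dem_right i (dem_right j z)))" for i j
  proof -
    have "act i (act j z) = dem_left i (dem_right i (dem_left j (dem_right j z)))"
      by (metis act_eq_dem act_involutions z)
    then show ?thesis by (simp add: dem_left_right[symmetric])
  qed
  show ?thesis unfolding * using ij by (simp add: dem_right_commute[of i j] dem_left_commute[of _ i j])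
qed

lemma act_braid:
  assumes z: "z \<in> involutions fpf"
  shows "act i (act (Suc i) (act i z)) = act (Suc i) (act i (act (Suc i) z))"
proof -
  note [simp] = involutions_inv[OF z]
  have *: "act i (act j (act i z)) = dem_left i (dem_left j (dem_left i (dem_right i (dem_right j (dem_right i z)))))" for i j
  proof -
    have "act i (act j (act i z)) =
       dem_left i (dem_right i (dem_left j (dem_right j (dem_left i (dem_right i z)))))"
      by (metis act_eq_dem act_involutions z)
    then show ?thesis by (simp add: dem_left_right[symmetric])
  qed
  show ?thesis unfolding * by (simp add: dem_right_braid dem_left_braid bij_is_inj)
qed

section \<open>Coefficients of words, and vanishing in the fixed-point-free module\<close>

text \<open>Generators send basis elements to multiples of basis elements, so a word acts on
  \<open>z\<close> through one coefficient, \<open>weight fpf a z\<close>, and one end point,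
  \<open>fold act a z\<close>.\<close>

fun weight :: "bool \<Rightarrow> nat list \<Rightarrow> perm \<Rightarrow> int poly" where
  "weight fpf [] z = 1"
| "weight fpf (i # a) z = act_coeff fpf i z * weight fpf a (act i z)"

text \<open>Detects whether the word kills \<open>z\<close> in the fixed-point-free module. This
  separates vanishing, checked by cases, from the power of \<open>beta\<close>, which the grading
  determines.\<close>

fun hits :: "nat list \<Rightarrow> perm \<Rightarrow> bool" where
  "hits [] z = False"
| "hits (i # a) z = (z (int i) = int i + 1 \<or> hits a (act i z))"

lemma weight_True:
  assumes "z \<in> involutions True"
  shows "weight True a z = (if hits a z then 0 else weight False a z)"
  using assms
proof (induction a arbitrary: z)
  case (Cons i a)
  have "z (int i + 1) = int i" if "z (int i) = int i + 1"
    using that involutionsD[OF Cons.prems, of "int i"] by simp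
  then show ?case using Cons act_involutions[OF Cons.prems] by (auto simp: act_coeff_def)
qed auto

lemma hits_commute:
  assumes z: "z \<in> involutions True" and ij: "Suc i < j"
  shows "hits [i, j] z \<longleftrightarrow> hits [j, i] z"
proof -
  have n: "z l \<noteq> l" for l using z by (simp add: involutions_def)
  have "act j z (int i) = int i + 1 \<longleftrightarrow> z (int i) = int i + 1"
    using ij n[of "int j"] by (auto simp: act_def sref_apply)
  moreover have "act i z (int j) = int j + 1 \<longleftrightarrow> z (int j) = int j + 1"
    using ij n[of "int i"] by (auto simp: act_def sref_apply)
  ultimately show ?thesis by auto
qed

text \<open>The common condition says that \<open>z\<close> matches two of the three points
  \<open>i\<close>, \<open>i + 1\<close>, \<open>i + 2\<close>; it is symmetric in the two braid
  words.\<close>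

lemma hits_braid_iff:
  assumes z: "z \<in> involutions True"
  shows "hits [i, Suc i, i] z \<longleftrightarrow>
    z (int i) = int i + 1 \<or> z (int i) = int i + 2 \<or> z (int i + 1) = int i + 2" (is ?A)
    "hits [Suc i, i, Suc i] z \<longleftrightarrow>
    z (int i) = int i + 1 \<or> z (int i) = int i + 2 \<or> z (int i + 1) = int i + 2" (is ?B)
proof -
  define a where "a = int i"
  note zz = involutionsD[OF z]
  have n: "z l \<noteq> l" for l using z by (simp add: involutions_def)
  \<comment> \<open>Only these three values matter. The facts \<open>r\<close> and \<open>d\<close>
    record that \<open>z\<close> is a fixed-point-free involution, which leaves a finite case
    analysis over integers.\<close>
  define x y w where "x = z a" "y = z (a + 1)" "w = z (a + 2)"
  have zs: "z a = x" "z (a + 1) = y" "z (a + 2) = w"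
    by (simp_all add: x_y_w_def)
  have r: "x = a + 1 \<longleftrightarrow> y = a" "x = a + 2 \<longleftrightarrow> w = a" "y = a + 2 \<longleftrightarrow> w = a + 1"
    by (metis zz x_y_w_def)+
  have d: "x \<noteq> y" "x \<noteq> w" "y \<noteq> w" "x \<noteq> a" "y \<noteq> a + 1" "w \<noteq> a + 2"
    by (auto simp: x_y_w_def involutions_eq_iff[OF z] n)
  have s: "sref i k = (if k = a then a + 1 else if k = a + 1 then a else k)"
    "sref (Suc i) k = (if k = a + 1 then a + 2 else if k = a + 2 then a + 1 else k)" for k
    by (auto simp: sref_apply a_def)
  have n1: "u \<in> involutions True \<Longrightarrow> act i u k = (if u a < u (a + 1) then sref i (u (sref i k)) else u k)"
    and n2: "u \<in> involutions True \<Longrightarrow> act (Suc i) u k = (if u (a + 1) < u (a + 2) then sref (Suc i) (u (sref (Suc i) k)) else u k)"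
    for u k
    by (auto simp: act_def a_def involutions_def add.commute)
  have a1: "int (Suc i) = a + 1" "int i = a" by (simp_all add: a_def)
  have a2: "a + 1 + 1 = a + 2" by simp
  have "act i z \<in> involutions True" "act (Suc i) z \<in> involutions True"
    by (rule act_involutions[OF z])+
  note I = z this
  have A: "hits [i, Suc i, i] z \<longleftrightarrow> x = a + 1 \<or> y = a + 2 \<or> x = a + 2"
  proof -
    define p q where "p = act i z a" and "q = act i z (a + 1)"
    have pq: "p = (if x < y then sref i y else x)" "q = (if x < y then sref i x else y)"
      "act i z (a + 2) = (if x < y then sref i w else w)"
      unfolding p_def q_def n1[OF I(1)] zs by (simp_all add: s zs)
    have "act (Suc i) (act i z) a = (if q < act i z (a + 2) then sref (Suc i) p else p)"
      unfolding n2[OF I(2)] by (simp add: s p_def q_def)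
    then have h: "hits [i, Suc i, i] z \<longleftrightarrow> x = a + 1 \<or> q = a + 2 \<or>
      (if q < act i z (a + 2) then sref (Suc i) p else p) = a + 1"
      unfolding hits.simps a1 a2 zs q_def[symmetric] by simp
    show ?thesis
      unfolding h pq s using d r by (smt (verit))
  qed
  have B: "hits [Suc i, i, Suc i] z \<longleftrightarrow> x = a + 1 \<or> y = a + 2 \<or> x = a + 2"
  proof -
    define p q where "p = act (Suc i) z a" and "q = act (Suc i) z (a + 1)"
    have pq: "p = (if y < w then sref (Suc i) x else x)" "q = (if y < w then sref (Suc i) w else y)"
      unfolding p_def q_def n2[OF I(1)] zs by (simp_all add: s zs)
    have "act i (act (Suc i) z) (a + 1) = (if p < q then sref i p else q)"
      unfolding n1[OF I(3)] by (simp add: s p_def q_def)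
    then have h: "hits [Suc i, i, Suc i] z \<longleftrightarrow> y = a + 2 \<or> p = a + 1 \<or>
      (if p < q then sref i p else q) = a + 2"
      unfolding hits.simps a1 a2 zs p_def[symmetric] by simp
    show ?thesis
      unfolding h pq s using d r by (smt (verit))
  qed
  show ?A ?B using A B a_def zs by auto
qed

section \<open>Grading\<close>

text \<open>Restricted to positions in \<open>{1..n}\<close> because \<open>one_fpf\<close> has
  infinitely many inversions on the integers.\<close>

definition inversions :: "nat \<Rightarrow> perm \<Rightarrow> (int \<times> int) set" where
  "inversions n w = {(k, l). k \<in> {1..int n} \<and> l \<in> {1..int n} \<and> k < l \<and> w l < w k}"

lemma finite_inversions [simp]: "finite (inversions n w)"
  by (rule finite_subset[of _ "{1..int n} \<times> {1..int n}"]) (auto simp: inversions_def)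

text \<open>Applying \<open>sref i\<close> to both coordinates embeds the old inversions into the
  new ones and misses only \<open>(i, i + 1)\<close>.\<close>

lemma card_inversions_right:
  assumes i: "i \<in> {1..<n}" and asc: "w (int i) < w (int i + 1)"
  shows "card (inversions n (w \<circ> sref i)) = Suc (card (inversions n w))"
proof -
  let ?f = "map_prod (sref i) (sref i)"
  have inj: "inj_on ?f A" for A by (auto simp: inj_on_def) (metis sref_apply_sref)+
  have lt: "sref i k < sref i l" if "k < l" "\<not> (k = int i \<and> l = int i + 1)" for k l
    using that by (auto simp: sref_apply)
  have rg: "sref i k \<in> {1..int n} \<longleftrightarrow> k \<in> {1..int n}" for k
    using i by (auto simp: sref_apply)
  have "inversions n (w \<circ> sref i) = insert (int i, int i + 1) (?f ` inversions n w)" (is "?L = ?R")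
  proof (intro equalityI subrelI)
    fix k l assume kl: "(k, l) \<in> ?L"
    show "(k, l) \<in> ?R"
    proof (cases "k = int i \<and> l = int i + 1")
      case False
      then have "(sref i k, sref i l) \<in> inversions n w"
        using kl lt[of k l] rg by (auto simp: inversions_def)
      then have "?f (sref i k, sref i l) \<in> ?f ` inversions n w" by blast
      then show ?thesis by simp
    qed auto
  next
    fix k l assume "(k, l) \<in> ?R"
    then consider "k = int i" "l = int i + 1" | p q where "k = sref i p" "l = sref i q" "(p, q) \<in> inversions n w"
      by auto
    then show "(k, l) \<in> ?L"
    proof cases
      case 1 then show ?thesis using i asc by (auto simp: inversions_def sref_apply)
    next
      case 2
      then have "\<not> (p = int i \<and> q = int i + 1)" using asc by (auto simp: inversions_def)
      then show ?thesis using 2 lt[of p q] rg by (auto simp: inversions_def)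
    qed
  qed
  moreover have "(int i, int i + 1) \<notin> ?f ` inversions n w"
  proof
    assume "(int i, int i + 1) \<in> ?f ` inversions n w"
    then obtain p q where "(p, q) \<in> inversions n w" "int i = sref i p" "int i + 1 = sref i q" by auto
    then show False by (auto simp: inversions_def sref_apply split: if_splits)
  qed
  ultimately show ?thesis by (simp add: card_image[OF inj])
qed

text \<open>Exchanging the values \<open>i\<close> and \<open>i + 1\<close> changes only the
  relative order at their positions \<open>p\<close> and \<open>q\<close>.\<close>

lemma card_inversions_left:
  assumes w: "inj w" and pq: "p \<in> {1..int n}" "q \<in> {1..int n}" "w p = int i" "w q = int i + 1" "p < q"
  shows "card (inversions n (sref i \<circ> w)) = Suc (card (inversions n w))"
proof -
  have ex: "w k = int i \<longleftrightarrow> k = p" "w k = int i + 1 \<longleftrightarrow> k = q" for k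
    using w pq by (metis injD)+
  have "inversions n (sref i \<circ> w) = insert (p, q) (inversions n w)"
  proof -
    have "sref i (w l) < sref i (w k) \<longleftrightarrow> (k = p \<and> l = q) \<or> w l < w k" if "k < l" for k l
    proof (cases "k = p \<and> l = q")
      case True
      then show ?thesis using pq by (simp add: sref_apply)
    next
      case False
      then show ?thesis using that pq(5) ex[of k] ex[of l] by (subst sref_less_iff) auto
    qed
    then show ?thesis using pq by (auto simp: inversions_def)
  qed
  moreover have "(p, q) \<notin> inversions n w" using pq by (auto simp: inversions_def)
  ultimately show ?thesis by simp
qed

text \<open>For an involution preserving \<open>{1..n}\<close> these are the smaller points of its
  2-cycles there, so their number is the number of those 2-cycles.\<close>

definition exceedances :: "nat \<Rightarrow> perm \<Rightarrow> int set" where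
  "exceedances n w = {k \<in> {1..int n}. k < w k}"

lemma finite_exceedances [simp]: "finite (exceedances n w)"
  by (rule finite_subset[of _ "{1..int n}"]) (auto simp: exceedances_def)

text \<open>
  The rank is twice the involution length, up to the constant \<open>rank n one_fpf\<close> in the
  fixed-point-free case.
\<close>

definition rank :: "nat \<Rightarrow> perm \<Rightarrow> nat" where
  "rank n z = card (inversions n z) + card (exceedances n z)"

text \<open>Behaviour outside \<open>{1..n}\<close> is left free, so that one notion covers both
  base points.\<close>

definition inv_states :: "nat \<Rightarrow> bool \<Rightarrow> perm set" where
  "inv_states n fpf = {z \<in> involutions fpf. \<forall>k\<in>{1..int n}. z k \<in> {1..int n}}"

lemma act_inv_states:
  assumes z: "z \<in> inv_states n fpf" and i: "i \<in> {1..<n}"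
  shows "act i z \<in> inv_states n fpf"
proof -
  have rg: "sref i k \<in> {1..int n} \<longleftrightarrow> k \<in> {1..int n}" for k
    using i by (auto simp: sref_apply)
  have "z \<in> involutions fpf" "\<And>k. k \<in> {1..int n} \<Longrightarrow> z k \<in> {1..int n}"
    using z by (auto simp: inv_states_def)
  then show ?thesis
    using act_involutions[of z fpf i] rg
    unfolding inv_states_def act_def by (auto simp del: atLeastAtMost_iff)
qed

text \<open>If \<open>z\<close> fixes \<open>i\<close> and \<open>i + 1\<close>, one inversion and
  one 2-cycle appear. Otherwise conjugation creates two inversions and keeps the number of
  2-cycles.\<close>

lemma rank_act:
  assumes z: "z \<in> inv_states n fpf" and i: "i \<in> {1..<n}" and asc: "z (int i) < z (int i + 1)"
  shows "rank n (act i z) = rank n z + 2"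
proof -
  have zi: "z \<in> involutions fpf" and zr: "\<And>k. k \<in> {1..int n} \<Longrightarrow> z k \<in> {1..int n}"
    using z by (auto simp: inv_states_def)
  note zz = involutionsD[OF zi]
  have rg: "sref i k \<in> {1..int n} \<longleftrightarrow> k \<in> {1..int n}" for k
    using i by (auto simp: sref_apply)
  have ir: "int i \<in> {1..int n}" "int i + 1 \<in> {1..int n}" using i by auto
  note R = card_inversions_right[OF i, of z, OF asc]
  show ?thesis
  proof (cases "z (int i) = int i \<and> z (int i + 1) = int i + 1")
    case True
    then have ez: "exceedances n (z \<circ> sref i) = insert (int i) (exceedances n z)"
      using ir by (auto simp: exceedances_def sref_apply)
    have "int i \<notin> exceedances n z" using True by (simp add: exceedances_def)
    then show ?thesis using True asc R ez by (simp add: rank_def act_def)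
  next
    case False
    have bij: "inj (z \<circ> sref i)"
      using involutions_inv(2)[OF zi] by (simp add: bij_comp bij_is_inj)
    have lt: "sref i (z (int i)) < sref i (z (int i + 1))"
      using False asc by (subst sref_less_iff) auto
    have zs: "sref i (z (int i)) \<in> {1..int n}" "sref i (z (int i + 1)) \<in> {1..int n}"
      using zr ir rg by blast+
    \<comment> \<open>The values \<open>i\<close> and \<open>i + 1\<close> of
      \<open>z \<circ> sref i\<close> sit at \<open>sref i (z i)\<close> and
      \<open>sref i (z (i + 1))\<close>, still in increasing order by \<open>lt\<close>.\<close>
    have I: "card (inversions n (sref i \<circ> (z \<circ> sref i))) = Suc (card (inversions n (z \<circ> sref i)))"
      by (rule card_inversions_left[OF bij zs _ _ lt]) (simp_all add: zz)
    have "exceedances n (sref i \<circ> z \<circ> sref i) = sref i ` exceedances n z"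
    proof -
      \<comment> \<open>At an ascent \<open>i\<close> and \<open>i + 1\<close> are not matched with
        each other, so \<open>sref i\<close> keeps the order of \<open>k\<close> and
        \<open>z k\<close>.\<close>
      have *: "k < z k \<longleftrightarrow> sref i k < sref i (z k)" for k
      proof (rule sref_less_iff[symmetric])
        show "\<not> (k = int i \<and> z k = int i + 1)" "\<not> (k = int i + 1 \<and> z k = int i)"
          using asc zz[of "int i"] zz[of "int i + 1"] by auto
      qed
      show ?thesis
      proof (intro equalityI subsetI)
        fix k assume "k \<in> exceedances n (sref i \<circ> z \<circ> sref i)"
        then have "sref i k \<in> exceedances n z"
          using *[of "sref i k"] rg[of k] by (simp add: exceedances_def)
        then show "k \<in> sref i ` exceedances n z" by (metis imageI sref_apply_sref)
      next
        fix k assume "k \<in> sref i ` exceedances n z"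
        then show "k \<in> exceedances n (sref i \<circ> z \<circ> sref i)"
          using * rg by (force simp: exceedances_def)
      qed
    qed
    moreover have "card (sref i ` exceedances n z) = card (exceedances n z)"
      by (rule card_image) (metis inj_onI sref_apply_sref)
    moreover have "act i z = sref i \<circ> z \<circ> sref i" using False asc by (auto simp: act_def)
    ultimately show ?thesis using R I by (simp add: rank_def o_assoc)
  qed
qed

lemma beta_nonzero [simp]: "beta \<noteq> 0" by (simp add: beta_def)

text \<open>Ascents contribute \<open>1\<close> and raise the rank by two; descents contribute
  \<open>beta\<close> and keep it. So \<open>N\<close> counts the descents met by the word.\<close>

lemma weight_False:
  assumes "z \<in> inv_states n fpf" "set a \<subseteq> {1..<n}"
  shows "\<exists>N. weight False a z = beta ^ N \<and> 2 * length a + rank n z = 2 * N + rank n (fold act a z)"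
  using assms
proof (induction a arbitrary: z)
  case (Cons i a)
  then have i: "i \<in> {1..<n}" by simp
  from Cons obtain N where N: "weight False a (act i z) = beta ^ N"
    "2 * length a + rank n (act i z) = 2 * N + rank n (fold act a (act i z))"
    using act_inv_states[of z n fpf i] by auto
  show ?case
  proof (cases "z (int i) < z (int i + 1)")
    case True
    with N rank_act[OF Cons.prems(1) i] show ?thesis by (intro exI[of _ N]) (auto simp: act_coeff_def)
  next
    case False
    then have "act i z = z" by (simp add: act_def)
    with False N show ?thesis by (intro exI[of _ "Suc N"]) (auto simp: act_coeff_def)
  qed
qed (auto intro: exI[of _ 0])

text \<open>By the grading, the exponent of \<open>beta\<close> depends only on the start, the end
  point and the length; coefficients need not be compared letter by letter.\<close>

lemma weight_cong:
  assumes z: "z \<in> inv_states n fpf" and ab: "set a \<subseteq> {1..<n}" "set b \<subseteq> {1..<n}"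
    and eq: "length a = length b" "fold act a z = fold act b z" "fpf \<Longrightarrow> hits a z \<longleftrightarrow> hits b z"
  shows "weight fpf a z = weight fpf b z"
proof -
  obtain N M where "weight False a z = beta ^ N" "weight False b z = beta ^ M"
    "2 * length a + rank n z = 2 * N + rank n (fold act a z)"
    "2 * length b + rank n z = 2 * M + rank n (fold act b z)"
    using weight_False[OF z ab(1)] weight_False[OF z ab(2)] by blast
  moreover then have "N = M" using eq by simp
  ultimately have "weight False a z = weight False b z" by simp
  then show ?thesis
    using weight_True[of z] z eq(3) by (cases fpf) (auto simp: inv_states_def)
qed

section \<open>Yang--Baxter products\<close>

text \<open>An abstract version of \<open>1 + x \<pi>\<^sub>i\<close>. Triviality from index
  \<open>n\<close> on lets all recursions below run past the last generator.\<close>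

locale yang_baxter =
  fixes n :: nat and b :: "'r::comm_ring_1" and H :: "nat \<Rightarrow> 'r \<Rightarrow> 'v \<Rightarrow> 'v"
  assumes trivial: "n \<le> i \<Longrightarrow> H i x v = v"
    and merge: "H i x (H i y v) = H i (x + y + b * x * y) v"
    and far: "Suc i < j \<Longrightarrow> H i x (H j y v) = H j y (H i x v)"
    and braid: "H i x (H (Suc i) (x + y + b * x * y) (H i y v)) =
      H (Suc i) y (H i (x + y + b * x * y) (H (Suc i) x v))"
begin

definition oplus :: "'r \<Rightarrow> 'r \<Rightarrow> 'r" where
  "oplus x y = x + y + b * x * y"

lemma oplus_commute: "oplus x y = oplus y x"
  by (simp add: oplus_def algebra_simps)

text \<open>This is \<open>A\<^sub>i(x)\<close>, and \<open>up\<close> is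
  \<open>B\<^sub>i(x)\<close>. The head of the list is the outermost operator, hence the leftmost
  factor and the first to act on the base point.\<close>

definition down :: "nat \<Rightarrow> 'r \<Rightarrow> 'v \<Rightarrow> 'v" where
  "down i x = foldr (\<lambda>a. H a x) (rev [i..<n])"

definition up :: "nat \<Rightarrow> 'r \<Rightarrow> 'v \<Rightarrow> 'v" where
  "up i x = foldr (\<lambda>a. H a x) [i..<n]"

lemma down_rec: "down i x v = down (Suc i) x (H i x v)"
  by (cases "i < n") (simp_all add: down_def upt_conv_Cons trivial)

lemma up_rec: "up i x v = H i x (up (Suc i) x v)"
  by (cases "i < n") (simp_all add: up_def upt_conv_Cons trivial)

lemma down_trivial: "n \<le> i \<Longrightarrow> down i x v = v"
  by (simp add: down_def)

lemma up_trivial: "n \<le> i \<Longrightarrow> up i x v = v"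
  by (simp add: up_def)

lemma foldr_far:
  assumes "\<And>p. p \<in> set ps \<Longrightarrow> Suc (l p) < j \<or> Suc j < l p"
  shows "foldr (\<lambda>p. H (l p) (w p)) ps (H j y v) = H j y (foldr (\<lambda>p. H (l p) (w p)) ps v)"
  using assms
proof (induction ps)
  case (Cons p ps)
  then have "Suc (l p) < j \<or> Suc j < l p" by simp
  then have "H (l p) (w p) (H j y u) = H j y (H (l p) (w p) u)" for u
    using far[of "l p" j] far[of j "l p"] by auto
  then show ?case using Cons by simp
qed simp

lemma up_far: "Suc j < i \<Longrightarrow> up i x (H j y v) = H j y (up i x v)"
  unfolding up_def by (rule foldr_far) auto

lemma down_far: "Suc j < i \<Longrightarrow> down i x (H j y v) = H j y (down i x v)"
  unfolding down_def by (rule foldr_far) auto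

lemma foldr_up_far:
  assumes "\<And>p. p \<in> set ps \<Longrightarrow> Suc (l p) < i"
  shows "foldr (\<lambda>p. H (l p) (w p)) ps (up i y v) = up i y (foldr (\<lambda>p. H (l p) (w p)) ps v)"
  using assms by (induction ps) (simp_all add: up_far)

text \<open>Induction from \<open>n\<close> downwards. The two factors of index \<open>i\<close>
  commute with everything of index at least \<open>i + 2\<close>, so they meet the factor of index
  \<open>i + 1\<close> in a Yang--Baxter triple.\<close>

lemma up_down: "up i x (down i y v) = down (Suc i) y (H i (oplus x y) (up (Suc i) x v))"
proof (induction "n - i" arbitrary: i v)
  case 0
  then show ?case by (simp add: up_trivial down_trivial trivial)
next
  case (Suc k)
  then have "k = n - Suc i" by simp
  note IH = Suc(1)[OF this]
  have "up i x (down i y v) = H i x (up (Suc i) x (down (Suc i) y (H i y v)))"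
    by (simp add: up_rec[of i] down_rec[of i])
  also have "\<dots> = H i x (down (Suc (Suc i)) y (H (Suc i) (oplus x y) (up (Suc (Suc i)) x (H i y v))))"
    by (simp add: IH)
  also have "\<dots> = down (Suc (Suc i)) y (H i x (H (Suc i) (oplus x y) (H i y (up (Suc (Suc i)) x v))))"
    by (simp add: up_far down_far)
  also have "\<dots> = down (Suc (Suc i)) y (H (Suc i) y (H i (oplus x y) (H (Suc i) x (up (Suc (Suc i)) x v))))"
    by (simp add: oplus_def braid)
  finally show ?case by (simp add: up_rec[of "Suc i"] down_rec[of "Suc i"])
qed

text \<open>Iterates \<open>up_down\<close>: each ascending factor passed leaves one
  \<open>H\<close> behind and raises the starting index of both products by one.\<close>

lemma ups_down:
  "foldr (\<lambda>j. up (k + j) (X j)) (rev [1..<Suc m]) (down (Suc k) y v) =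
   down (Suc (k + m)) y (foldr (\<lambda>j. H (k + j) (oplus y (X j))) (rev [1..<Suc m])
     (foldr (\<lambda>j. up (Suc k + j) (X j)) (rev [1..<Suc m]) v))"
proof (induction m)
  case (Suc m)
  let ?h = "foldr (\<lambda>j. H (k + j) (oplus y (X j))) (rev [1..<Suc m])"
  let ?u = "foldr (\<lambda>j. up (Suc k + j) (X j)) (rev [1..<Suc m])"
  \<comment> \<open>The new ascending factor starts at least two above every index in
    \<open>?h\<close>, so it moves to the right of them.\<close>
  have "?h (up (Suc (Suc (k + m))) z v) = up (Suc (Suc (k + m))) z (?h v)" for z v
    by (rule foldr_up_far) auto
  with Suc show ?case by (simp add: up_down oplus_commute)
qed simp

text \<open>This is \<open>R\<^sub>k\<close>; the factors run through \<open>j\<close> in decreasing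
  order, as \<open>prec\<close> reads a row.\<close>

definition row :: "bool \<Rightarrow> (nat \<Rightarrow> 'r) \<Rightarrow> nat \<Rightarrow> 'v \<Rightarrow> 'v" where
  "row fpf X k = foldr (\<lambda>j. H (k + j - 1) (if k = j then X k else oplus (X k) (X j)))
     (rev [1..<(if fpf then k else Suc k)])"

definition rows :: "bool \<Rightarrow> (nat \<Rightarrow> 'r) \<Rightarrow> nat \<Rightarrow> 'v \<Rightarrow> 'v" where
  "rows fpf X k = foldr (row fpf X) [1..<Suc k]"

text \<open>The ascending factors left over to the right of the first \<open>k\<close> rows. They
  all start beyond \<open>k\<close>, so they are trivial for \<open>k = n\<close>.\<close>

definition ups :: "(nat \<Rightarrow> 'r) \<Rightarrow> nat \<Rightarrow> 'v \<Rightarrow> 'v" where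
  "ups X k = foldr (\<lambda>j. up (k + j) (X j)) (rev [1..<Suc k])"

lemma row_Suc:
  "row fpf X (Suc k) v = (if fpf then id else H (2 * k + 1) (X (Suc k)))
     (foldr (\<lambda>j. H (k + j) (oplus (X (Suc k)) (X j))) (rev [1..<Suc k]) v)"
proof -
  have "foldr (\<lambda>j. H (Suc k + j - 1) (if Suc k = j then X (Suc k) else oplus (X (Suc k)) (X j))) (rev [1..<Suc k]) v
    = foldr (\<lambda>j. H (k + j) (oplus (X (Suc k)) (X j))) (rev [1..<Suc k]) v"
    by (rule foldr_cong) auto
  then show ?thesis by (simp add: row_def mult_2)
qed

text \<open>The indices occurring in row \<open>k\<close> are at most
  \<open>2 * k - 1\<close>.\<close>

lemma row_commute:
  assumes "\<And>j x v. Suc j < i \<Longrightarrow> g (H j x v) = H j x (g v)" and "2 * k < i"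
  shows "row fpf X k (g v) = g (row fpf X k v)"
proof -
  have "foldr (\<lambda>j. H (k + j - 1) (w j)) js (g v) = g (foldr (\<lambda>j. H (k + j - 1) (w j)) js v)"
    if "set js \<subseteq> {1..k}" for w js
    using that assms by (induction js) auto
  moreover have "set (rev [1..<(if fpf then k else Suc k)]) \<subseteq> {1..k}"
    by auto
  ultimately show ?thesis unfolding row_def by (simp del: set_rev set_upt)
qed

lemma rows_commute:
  assumes "\<And>j x v. Suc j < i \<Longrightarrow> g (H j x v) = H j x (g v)" and "2 * k < i"
  shows "rows fpf X k (g v) = g (rows fpf X k v)"
  using assms(2)
proof (induction k arbitrary: v)
  case (Suc k)
  have "row fpf X (Suc k) (g v) = g (row fpf X (Suc k) v)"
    by (rule row_commute) (use Suc.prems assms(1) in auto)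
  with Suc show ?case by (simp add: rows_def)
qed (simp add: rows_def)

text \<open>
  Pushing \<open>down (k + 1)\<close> through \<open>ups X k\<close> turns it into the off-diagonal part of row \<open>k + 1\<close> and a
  factor \<open>down (2 * k + 1)\<close>. The latter commutes with all earlier rows and is reversed at the
  base point, which yields the diagonal entry.
\<close>

lemma rows_downs:
  fixes \<mu> :: "'v \<Rightarrow> 'w"
  assumes base: "\<And>k y v. \<mu> (down (2 * k + 1) y v) =
    \<mu> ((if fpf then id else H (2 * k + 1) y) (up (2 * k + 2) y v))"
  shows "\<mu> (foldr (\<lambda>i. down i (X i)) [1..<Suc k] v) = \<mu> (rows fpf X k (ups X k v))"
proof (induction k arbitrary: v)
  case 0
  then show ?case by (simp add: rows_def ups_def)
next
  case (Suc k)
  let ?y = "X (Suc k)"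
  let ?d = "if fpf then id else H (2 * k + 1) ?y"
  let ?h = "foldr (\<lambda>j. H (k + j) (oplus ?y (X j))) (rev [1..<Suc k])"
  let ?u = "foldr (\<lambda>j. up (Suc k + j) (X j)) (rev [1..<Suc k])"
  have "\<mu> (foldr (\<lambda>i. down i (X i)) [1..<Suc (Suc k)] v) = \<mu> (rows fpf X k (ups X k (down (Suc k) ?y v)))"
    using Suc[of "down (Suc k) ?y v"] by simp
  also have "\<dots> = \<mu> (rows fpf X k (down (2 * k + 1) ?y (?h (?u v))))"
    using ups_down[of k X k ?y v] by (simp add: ups_def mult_2 del: upt_Suc)
  also have "\<dots> = \<mu> (down (2 * k + 1) ?y (rows fpf X k (?h (?u v))))"
    by (subst rows_commute[where i = "2 * k + 1"]) (auto intro: down_far)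
  also have "\<dots> = \<mu> (?d (up (2 * k + 2) ?y (rows fpf X k (?h (?u v)))))"
    by (rule base)
  also have "?d (up (2 * k + 2) ?y (rows fpf X k (?h (?u v)))) =
      rows fpf X k (?d (up (2 * k + 2) ?y (?h (?u v))))"
  proof -
    have "rows fpf X k (H (2 * k + 1) ?y v) = H (2 * k + 1) ?y (rows fpf X k v)" for v
      by (rule rows_commute[where i = "2 * k + 1"]) (auto intro: far[symmetric])
    moreover have "rows fpf X k (up (2 * k + 2) ?y v) = up (2 * k + 2) ?y (rows fpf X k v)" for v
      by (rule rows_commute[where i = "2 * k + 2"]) (auto simp: up_far)
    ultimately show ?thesis by (cases fpf) (simp_all del: upt_Suc)
  qed
  \<comment> \<open>The reversed factor moves right and becomes the term \<open>j = k + 1\<close> of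
    \<open>ups X (Suc k)\<close>.\<close>
  also have "up (2 * k + 2) ?y (?h (?u v)) = ?h (up (2 * k + 2) ?y (?u v))"
    by (rule foldr_up_far[symmetric]) auto
  also have "?d (?h (up (2 * k + 2) ?y (?u v))) = row fpf X (Suc k) (ups X (Suc k) v)"
    by (simp add: row_Suc ups_def mult_2)
  finally show ?case by (simp add: rows_def)
qed

theorem rows_eq_downs:
  fixes \<mu> :: "'v \<Rightarrow> 'w"
  assumes "\<And>k y v. \<mu> (down (2 * k + 1) y v) =
    \<mu> ((if fpf then id else H (2 * k + 1) y) (up (2 * k + 2) y v))"
  shows "\<mu> (foldr (\<lambda>i. down i (X i)) [1..<Suc n] v) = \<mu> (rows fpf X n v)"
proof -
  have "foldr (\<lambda>j. up (n + j) (X j)) js v = v" for js :: "nat list"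
    by (induction js) (simp_all add: up_trivial)
  then have "ups X n v = v" by (simp only: ups_def)
  then show ?thesis using rows_downs[OF assms, of X n v] by simp
qed

section \<open>Reversal of descending products at the base point\<close>

text \<open>Here \<open>\<mu>\<close> stands for evaluation at the base point. Once
  \<open>down (Suc i)\<close> is reversed by induction, \<open>H i\<close> moves left past
  \<open>up (i + 2)\<close> and is exchanged with \<open>H (Suc i)\<close>.\<close>

lemma base_involution:
  fixes \<mu> :: "'v \<Rightarrow> 'w"
  assumes "\<And>i y v. \<mu> (H (Suc i) y (H i y v)) = \<mu> (H i y (H (Suc i) y v))"
  shows "\<mu> (down i y v) = \<mu> (up i y v)"
proof (induction "n - i" arbitrary: i v)
  case 0
  then show ?case by (simp add: up_trivial down_trivial)
next
  case (Suc k)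
  then have "\<mu> (down i y v) = \<mu> (H (Suc i) y (up (Suc (Suc i)) y (H i y v)))"
    by (simp add: down_rec[of i] up_rec[symmetric])
  then show ?case
    using assms by (simp add: up_far up_rec[of i] up_rec[of "Suc i"])
qed

text \<open>Induction in steps of two: reversing \<open>down (2 * k + 3)\<close> gives
  \<open>up (2 * k + 4)\<close>, and the base relation then trades the index
  \<open>2 * k + 1\<close> for the missing \<open>2 * k + 3\<close>.\<close>

lemma base_fpf:
  fixes \<mu> :: "'v \<Rightarrow> 'w"
  assumes "\<And>k y v. \<mu> (H (2 * k + 2) y (H (2 * k + 1) y v)) = \<mu> (H (2 * k + 2) y (H (2 * k + 3) y v))"
  shows "\<mu> (down (2 * k + 1) y v) = \<mu> (up (2 * k + 2) y v)"
proof (induction "n - 2 * k" arbitrary: k v rule: less_induct)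
  case less
  show ?case
  proof (cases "n \<le> 2 * k + 1")
    case True
    then show ?thesis by (simp add: up_trivial down_trivial)
  next
    case False
    have "\<mu> (down (2 * k + 1) y v) = \<mu> (down (2 * Suc k + 1) y (H (2 * k + 2) y (H (2 * k + 1) y v)))"
      by (simp add: down_rec[of "Suc (2 * k)"] down_rec[of "Suc (Suc (2 * k))"])
    also have "\<dots> = \<mu> (up (2 * Suc k + 2) y (H (2 * k + 2) y (H (2 * k + 1) y v)))"
      using False by (intro less) auto
    also have "\<dots> = \<mu> (H (2 * k + 2) y (H (2 * k + 1) y (up (2 * k + 4) y v)))"
      by (simp add: up_far numeral_eq_Suc)
    also have "\<dots> = \<mu> (H (2 * k + 2) y (H (2 * k + 3) y (up (2 * k + 4) y v)))"
      by (rule assms)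
    finally show ?thesis
      using up_rec[of "2 * k + 2"] up_rec[of "2 * k + 3"] by (simp add: numeral_eq_Suc)
  qed
qed

end

section \<open>Generating functions of words\<close>

abbreviation const :: "int poly \<Rightarrow> gpoly" where
  "const \<equiv> Poly_Mapping.single 0"

lemma const_mult: "const (c * d) = const c * const d"
  by (simp add: mult_single)

lemma const_power: "const (c ^ N) = const c ^ N"
  by (induction N) (simp_all add: const_mult)

text \<open>
  The transpose of the right action of \<open>\<pi>\<^sub>i\<close>: it acts from the left on linear functionals, which are
  arbitrary functions on basis elements, so no finite support has to be tracked. Generators with
  index outside \<open>{1..<n}\<close> act as zero, which lets products over the whole staircase be written
  without truncation.
\<close>

definition gen_op :: "nat \<Rightarrow> bool \<Rightarrow> nat \<Rightarrow> (perm \<Rightarrow> gpoly) \<Rightarrow> perm \<Rightarrow> gpoly" where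
  "gen_op n fpf i f z =
     (if z \<in> inv_states n fpf \<and> i \<in> {1..<n} then const (act_coeff fpf i z) * f (act i z) else 0)"

lemma foldr_gen_op:
  assumes "z \<in> inv_states n fpf"
  shows "foldr (gen_op n fpf) a f z =
    (if set a \<subseteq> {1..<n} then const (weight fpf a z) * f (fold act a z) else 0)"
  using assms
proof (induction a arbitrary: z)
  case (Cons i a)
  show ?case
  proof (cases "i \<in> {1..<n}")
    case True
    then show ?thesis
      using Cons act_inv_states[of z n fpf i] by (simp add: gen_op_def const_mult mult.assoc)
  next
    case False
    then show ?thesis using Cons.prems by (auto simp: gen_op_def)
  qed
qed simp

text \<open>Operator identities reduce to \<open>weight_cong\<close>. Nonemptiness makes both sides
  vanish outside \<open>inv_states\<close>, where an empty word would return
  \<open>f z\<close>.\<close>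

lemma gen_op_cong:
  assumes "a \<noteq> []" "b \<noteq> []" "set a = set b" "length a = length b"
    and "\<And>z. z \<in> involutions fpf \<Longrightarrow> fold act a z = fold act b z"
    and "\<And>z. z \<in> involutions True \<Longrightarrow> hits a z = hits b z"
  shows "foldr (gen_op n fpf) a f z = foldr (gen_op n fpf) b f z"
proof (cases "z \<in> inv_states n fpf")
  case True
  then have z: "z \<in> involutions fpf" by (simp add: inv_states_def)
  show ?thesis
  proof (cases "set a \<subseteq> {1..<n}")
    case a: True
    have "weight fpf a z = weight fpf b z"
      using True a assms z by (intro weight_cong[of z n fpf a b]) auto
    then show ?thesis using True a assms z by (simp add: foldr_gen_op)
  next
    case False
    then show ?thesis using True assms by (simp add: foldr_gen_op)
  qed
next
  case False
  then show ?thesis using assms(1,2) by (cases a; cases b) (auto simp: gen_op_def)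
qed

lemma gen_op_far:
  assumes "Suc i < j"
  shows "gen_op n fpf i (gen_op n fpf j f) z = gen_op n fpf j (gen_op n fpf i f) z"
proof -
  have "foldr (gen_op n fpf) [i, j] f z = foldr (gen_op n fpf) [j, i] f z"
    using assms act_commute[of _ fpf i j] hits_commute[of _ i j]
    by (intro gen_op_cong) (auto simp del: hits.simps)
  then show ?thesis by simp
qed

lemma gen_op_braid:
  "gen_op n fpf i (gen_op n fpf (Suc i) (gen_op n fpf i f)) z =
   gen_op n fpf (Suc i) (gen_op n fpf i (gen_op n fpf (Suc i) f)) z"
proof (cases "i \<in> {1..<n} \<and> Suc i \<in> {1..<n}")
  case True
  have "foldr (gen_op n fpf) [i, Suc i, i] f z = foldr (gen_op n fpf) [Suc i, i, Suc i] f z"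
    using act_braid hits_braid_iff
    by (intro gen_op_cong) (auto simp del: hits.simps)
  then show ?thesis by simp
next
  case False
  then show ?thesis by (auto simp: gen_op_def)
qed

lemma gen_op_quadratic: "gen_op n fpf i (gen_op n fpf i f) z = Beta * gen_op n fpf i f z"
proof (cases "z \<in> inv_states n fpf \<and> i \<in> {1..<n}")
  case True
  then have zi: "z \<in> involutions fpf" by (simp add: inv_states_def)
  have "gen_op n fpf i (gen_op n fpf i f) z =
      const (act_coeff fpf i z * act_coeff fpf i (act i z)) * f (act i (act i z))"
    using True act_inv_states[of z n fpf i] by (simp add: gen_op_def const_mult mult.assoc)
  also have "\<dots> = Beta * gen_op n fpf i f z"
    unfolding act_coeff_quadratic[OF zi] using True
    by (simp add: gen_op_def const_mult Beta_def mult.assoc)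
  finally show ?thesis .
qed (auto simp: gen_op_def)

text \<open>The transpose of \<open>1 + x \<pi>\<^sub>i\<close>.\<close>

definition exp_op :: "nat \<Rightarrow> bool \<Rightarrow> nat \<Rightarrow> gpoly \<Rightarrow> (perm \<Rightarrow> gpoly) \<Rightarrow> perm \<Rightarrow> gpoly" where
  "exp_op n fpf i x f = (\<lambda>z. f z + x * gen_op n fpf i f z)"

lemma exp_op_apply: "exp_op n fpf i x f z = f z + x * gen_op n fpf i f z"
  by (simp add: exp_op_def)

lemma gen_op_plus:
  "gen_op n fpf i (\<lambda>z. f z + x * g z) = (\<lambda>z. gen_op n fpf i f z + x * gen_op n fpf i g z)"
  by (simp add: gen_op_def fun_eq_iff algebra_simps)

lemma gen_op_exp_op:
  "gen_op n fpf i (exp_op n fpf j y f) =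
   (\<lambda>z. gen_op n fpf i f z + y * gen_op n fpf i (gen_op n fpf j f) z)"
  unfolding exp_op_def by (rule gen_op_plus)

text \<open>Both sides are expanded into words in the generators; the quadratic relation turns
  repeated letters into \<open>Beta\<close>, and the remaining words match by the far and braid
  relations.\<close>

lemma yang_baxter_exp_op: "yang_baxter n Beta (exp_op n fpf)"
proof
  fix i j :: nat and x y :: gpoly and v :: "perm \<Rightarrow> gpoly"
  note expand = fun_eq_iff exp_op_apply gen_op_exp_op gen_op_plus gen_op_quadratic
  show "n \<le> i \<Longrightarrow> exp_op n fpf i x v = v"
    by (simp add: exp_op_def gen_op_def)
  show "exp_op n fpf i x (exp_op n fpf i y v) = exp_op n fpf i (x + y + Beta * x * y) v"
    by (simp only: expand) (simp add: algebra_simps)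
  show "Suc i < j \<Longrightarrow> exp_op n fpf i x (exp_op n fpf j y v) = exp_op n fpf j y (exp_op n fpf i x v)"
    by (simp only: expand gen_op_far[of i j]) (simp add: algebra_simps)
  show "exp_op n fpf i x (exp_op n fpf (Suc i) (x + y + Beta * x * y) (exp_op n fpf i y v)) =
      exp_op n fpf (Suc i) y (exp_op n fpf i (x + y + Beta * x * y) (exp_op n fpf (Suc i) x v))"
    by (simp only: expand gen_op_braid[of n fpf i]) (simp add: algebra_simps)
qed

text \<open>Multiplying out the product: \<open>D\<close> is the set of positions where
  \<open>x \<pi>\<^sub>i\<close> is chosen instead of \<open>1\<close>.\<close>

lemma foldr_exp_op_expand:
  assumes "distinct ps"
  shows "foldr (\<lambda>p. exp_op n fpf (l p) (w p)) ps f z =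
    (\<Sum>D\<in>Pow (set ps). (\<Prod>p\<in>D. w p) * foldr (gen_op n fpf) (map l (filter (\<lambda>p. p \<in> D) ps)) f z)"
  using assms
proof (induction ps arbitrary: z)
  case (Cons p ps)
  let ?t = "\<lambda>D z. (\<Prod>p\<in>D. w p) * foldr (gen_op n fpf) (map l (filter (\<lambda>p. p \<in> D) ps)) f z"
  let ?s = "\<lambda>D. (\<Prod>p\<in>D. w p) * foldr (gen_op n fpf) (map l (filter (\<lambda>p. p \<in> D) (p # ps))) f z"
  let ?P = "Pow (set ps)"
  have p: "p \<notin> set ps" using Cons.prems by simp
  have IH: "foldr (\<lambda>p. exp_op n fpf (l p) (w p)) ps f = (\<lambda>z. \<Sum>D\<in>?P. ?t D z)"
    using Cons by (simp add: fun_eq_iff)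
  have disj: "?P \<inter> insert p ` ?P = {}" using p by auto
  have inj: "inj_on (insert p) ?P" using p by (auto simp: inj_on_def)
  have "(\<Sum>D\<in>Pow (set (p # ps)). ?s D) = (\<Sum>D\<in>?P. ?s D) + (\<Sum>D\<in>?P. ?s (insert p D))"
    by (simp add: Pow_insert sum.union_disjoint[OF _ _ disj] sum.reindex[OF inj])
  also have "(\<Sum>D\<in>?P. ?s D) = (\<Sum>D\<in>?P. ?t D z)"
    by (rule sum.cong) (use p in auto)
  also have "(\<Sum>D\<in>?P. ?s (insert p D)) = (\<Sum>D\<in>?P. w p * gen_op n fpf (l p) (\<lambda>z. ?t D z) z)"
  proof (rule sum.cong)
    fix D assume D: "D \<in> ?P"
    then have "p \<notin> D" "finite D" using p finite_subset by auto
    moreover have "filter (\<lambda>q. q \<in> insert p D) ps = filter (\<lambda>q. q \<in> D) ps"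
      using p by (intro filter_cong) auto
    ultimately show "?s (insert p D) = w p * gen_op n fpf (l p) (\<lambda>z. ?t D z) z"
      by (simp add: gen_op_def[of _ _ "l p"] mult.assoc mult.left_commute)
  qed simp
  also have "\<dots> = w p * gen_op n fpf (l p) (\<lambda>z. \<Sum>D\<in>?P. ?t D z) z"
    by (cases "z \<in> inv_states n fpf \<and> l p \<in> {1..<n}")
      (simp_all only: gen_op_def[of _ _ "l p"] sum_distrib_left simp_thms if_True if_False mult_zero_right sum.neutral_const)
  finally show ?case by (simp only: foldr_Cons o_apply IH) (simp only: exp_op_apply)
qed simp

section \<open>Translation of the given module actions into \<open>act\<close> and
  \<open>weight\<close>\<close>

lemma scale_single: "scale c (Poly_Mapping.single y d) = Poly_Mapping.single y (c * d)"
  unfolding scale_def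
  by (rule poly_mapping_eqI) (simp add: Poly_Mapping.map.rep_eq lookup_single when_def)

lemma lin_ext_single: "lin_ext g (Poly_Mapping.single y c) = scale c (g y)"
proof (cases "c = 0")
  case True
  have "scale 0 v = 0" for v
    unfolding scale_def
    by (rule poly_mapping_eqI) (simp add: Poly_Mapping.map.rep_eq when_def)
  then show ?thesis using True by (simp add: lin_ext_def)
qed (simp add: lin_ext_def)

text \<open>If \<open>z\<close> commutes with \<open>sref i\<close>, it preserves
  \<open>{i, i + 1}\<close>; at an ascent it must then fix both points.\<close>

lemma invol_basis_act_eq:
  assumes z: "z \<in> involutions fpf"
  shows "invol_basis_act i z = Poly_Mapping.single (act i z) (act_coeff False i z)"
proof -
  have "z \<circ> sref i = sref i \<circ> z \<longleftrightarrow> z (int i) = int i \<and> z (int i + 1) = int i + 1"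
    if asc: "z (int i) < z (int i + 1)"
  proof
    assume "z \<circ> sref i = sref i \<circ> z"
    then have "z (sref i (int i)) = sref i (z (int i))" by (metis comp_apply)
    then show "z (int i) = int i \<and> z (int i + 1) = int i + 1"
      using asc by (auto simp: sref_apply split: if_splits)
  next
    assume fx: "z (int i) = int i \<and> z (int i + 1) = int i + 1"
    have "z k = int i \<longleftrightarrow> k = int i" "z k = int i + 1 \<longleftrightarrow> k = int i + 1" for k
      using fx involutionsD[OF z] by metis+
    then show "z \<circ> sref i = sref i \<circ> z" using fx by (auto simp: sref_apply)
  qed
  then show ?thesis
    by (auto simp: invol_basis_act_def act_def act_coeff_def mbasis_def scale_single)
qed

lemma fixed_basis_act_eq:
  assumes z: "z \<in> involutions True"
  shows "fixed_basis_act i z = Poly_Mapping.single (act i z) (act_coeff True i z)"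
proof -
  have "z (int i) \<noteq> int i" using z by (simp add: involutions_def)
  moreover have "z (int i) = int i + 1 \<longleftrightarrow> z (int i + 1) = int i"
    using involutionsD[OF z] by metis
  ultimately show ?thesis
    by (auto simp: fixed_basis_act_def act_def act_coeff_def mbasis_def scale_single)
qed

lemma foldl_invol_act:
  assumes "z \<in> involutions False"
  shows "foldl invol_act (Poly_Mapping.single z c) a =
    Poly_Mapping.single (fold act a z) (c * weight False a z)"
  using assms
  by (induction a arbitrary: z c)
    (simp_all add: invol_act_def lin_ext_single invol_basis_act_eq scale_single act_involutions mult.assoc)

lemma foldl_fixed_act:
  assumes "z \<in> involutions True"
  shows "foldl fixed_act (Poly_Mapping.single z c) a =
    Poly_Mapping.single (fold act a z) (c * weight True a z)"
  using assms
  by (induction a arbitrary: z c)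
    (simp_all add: fixed_act_def lin_ext_single fixed_basis_act_eq scale_single act_involutions mult.assoc)

lemma weight_cases:
  assumes "z \<in> inv_states n fpf" "set a \<subseteq> {1..<n}" "weight fpf a z \<noteq> 0"
  shows "\<exists>N. weight fpf a z = beta ^ N \<and> 2 * length a + rank n z = 2 * N + rank n (fold act a z)"
  using weight_False[OF assms(1,2)] weight_True[of z a] assms
  by (cases fpf) (auto simp: inv_states_def split: if_splits)

lemma single_eq_iff:
  "d \<noteq> 0 \<Longrightarrow> Poly_Mapping.single y c = Poly_Mapping.single z d \<longleftrightarrow> y = z \<and> c = d"
  by (metis lookup_single_eq lookup_single_not_eq)

lemma id_inv_states: "id \<in> inv_states n False"
  by (simp add: inv_states_def involutions_def)

text \<open>\<open>one_fpf\<close> matches each odd number with its successor, so for even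
  \<open>n\<close> these pairs fill \<open>{1..n}\<close>.\<close>

lemma one_fpf_inv_states:
  assumes "even n"
  shows "one_fpf \<in> inv_states n True"
proof -
  have "k \<noteq> 1" if "even k" for k :: int using that by auto
  moreover have "k \<noteq> int n" if "odd k" for k using that assms by auto
  ultimately have "one_fpf k \<in> {1..int n}" if "k \<in> {1..int n}" for k
    using that by (cases "even k") (force simp: one_fpf_def)+
  moreover have "one_fpf (one_fpf k) = k" "one_fpf k \<noteq> k" for k
    by (auto simp: one_fpf_def)
  ultimately show ?thesis
    by (simp add: inv_states_def involutions_def fun_eq_iff)
qed

text \<open>A nonzero weight is automatically a power of \<open>beta\<close>, which removes the
  existential quantifier over \<open>N\<close>.\<close>

lemma InvHecke_iff:
  assumes "z \<in> Invol n \<and> \<not> fpf \<or> z \<in> Invol_fpf n \<and> even n \<and> fpf"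
  shows "a \<in> InvHecke n z \<longleftrightarrow> set a \<subseteq> {1..<n} \<and>
    fold act a (if fpf then one_fpf else id) = z \<and> weight fpf a (if fpf then one_fpf else id) \<noteq> 0"
proof -
  let ?e = "if fpf then one_fpf else id"
  have e: "?e \<in> inv_states n fpf"
    using assms id_inv_states one_fpf_inv_states by auto
  then have e': "?e \<in> involutions fpf" by (simp add: inv_states_def)
  have "{1..n - 1} = {1..<n}" by auto
  moreover have "z \<in> Invol_fpf n \<longleftrightarrow> fpf" "z \<in> Invol n \<longleftrightarrow> \<not> fpf"
    using assms Invol_disjoint[of n] by auto
  ultimately have "a \<in> InvHecke n z \<longleftrightarrow> set a \<subseteq> {1..<n} \<and>
      (\<exists>N. Poly_Mapping.single (fold act a ?e) (weight fpf a ?e) = Poly_Mapping.single z (beta ^ N))"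
    using foldl_invol_act[of id 1 a] foldl_fixed_act[of one_fpf 1 a] e'
    by (cases fpf) (simp_all add: InvHecke_def mbasis_def scale_single)
  also have "\<dots> \<longleftrightarrow> set a \<subseteq> {1..<n} \<and> fold act a ?e = z \<and> (\<exists>N. weight fpf a ?e = beta ^ N)"
    by (auto simp: single_eq_iff)
  also have "\<dots> \<longleftrightarrow> set a \<subseteq> {1..<n} \<and> fold act a ?e = z \<and> weight fpf a ?e \<noteq> 0"
    using weight_cases[OF e, of a] by auto
  finally show ?thesis .
qed

text \<open>Letters met at a descent do not move the basis element; deleting them leaves only
  ascents.\<close>

lemma reduced_subword:
  assumes "weight fpf a z \<noteq> 0"
  shows "\<exists>b. set b \<subseteq> set a \<and> fold act b z = fold act a z \<and> weight fpf b z = 1"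
  using assms
proof (induction a arbitrary: z)
  case (Cons i a)
  then obtain b where b: "set b \<subseteq> set a" "fold act b (act i z) = fold act a (act i z)"
    "weight fpf b (act i z) = 1" by fastforce
  show ?case
  proof (cases "z (int i) < z (int i + 1)")
    case True
    then show ?thesis using b by (intro exI[of _ "i # b"]) (auto simp: act_coeff_def)
  next
    case False
    then have "act i z = z" by (simp add: act_def)
    then show ?thesis using b by (intro exI[of _ b]) auto
  qed
qed (auto intro: exI[of _ "[]"])

lemma beta_power_eq_iff: "beta ^ N = beta ^ M \<longleftrightarrow> N = M"
proof -
  have "degree (beta ^ N) = N" for N by (simp add: degree_power_eq) (simp add: beta_def)
  then show ?thesis by metis
qed

text \<open>The functional reads off the coefficient of \<open>m\<^sub>z\<close>, so the left side
  is the coefficient produced by \<open>a\<close> from the base point.\<close>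

lemma foldr_gen_op_InvHecke:
  assumes z: "z \<in> Invol n \<and> \<not> fpf \<or> z \<in> Invol_fpf n \<and> even n \<and> fpf"
  shows "foldr (gen_op n fpf) a (\<lambda>w. if w = z then 1 else 0) (if fpf then one_fpf else id) =
    (if a \<in> InvHecke n z then Beta ^ (length a - inv_len n z) else 0)"
proof -
  let ?e = "if fpf then one_fpf else id"
  have e: "?e \<in> inv_states n fpf"
    using z id_inv_states one_fpf_inv_states by auto
  note iff = InvHecke_iff[OF z]
  show ?thesis
  proof (cases "a \<in> InvHecke n z")
    case True
    then obtain N where N: "weight fpf a ?e = beta ^ N" "2 * length a + rank n ?e = 2 * N + rank n z"
      using weight_cases[OF e, of a] iff by auto
    obtain b where b: "b \<in> InvHecke n z" "weight fpf b ?e = 1"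
      using reduced_subword[of fpf a ?e] True iff by fastforce
    \<comment> \<open>Weight \<open>1\<close> forces exponent \<open>0\<close>, so the ranks fix the
      length of \<open>b\<close>, and the same equation makes every other Hecke word at least as
      long.\<close>
    have lb: "2 * length b + rank n ?e = rank n z"
      using weight_cases[OF e, of b] b iff beta_power_eq_iff[of 0] by auto
    have "inv_len n z = length b"
      unfolding inv_len_def
    proof (rule Least_equality)
      fix k assume "\<exists>a\<in>InvHecke n z. k = length a"
      then obtain c where c: "c \<in> InvHecke n z" "k = length c" by blast
      then obtain M where "2 * length c + rank n ?e = 2 * M + rank n z"
        using weight_cases[OF e, of c] iff[of c] by blast
      with c show "length b \<le> k" using lb by linarith
    qed (use b in blast)
    then have "N = length a - inv_len n z" using lb N by simp
    then have "const (weight fpf a ?e) = Beta ^ (length a - inv_len n z)"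
      using N(1) by (simp only: const_power Beta_def)
    moreover have "set a \<subseteq> {1..<n}" "fold act a ?e = z"
      using True unfolding iff by blast+
    ultimately show ?thesis
      unfolding foldr_gen_op[OF e] by (simp only: True if_True simp_thms mult_1_right)
  next
    case False
    then show ?thesis unfolding foldr_gen_op[OF e] iff by auto
  qed
qed

section \<open>Pipe dreams and compatible sequences\<close>

text \<open>From the identity, both orders of the two generators reach the transposition of
  \<open>i\<close> and \<open>i + 2\<close> with coefficient \<open>1\<close>.\<close>

lemma base_id:
  "exp_op n False (Suc i) y (exp_op n False i y v) id =
   exp_op n False i y (exp_op n False (Suc i) y v) id"
proof -
  have "gen_op n False (Suc i) (gen_op n False i v) id = gen_op n False i (gen_op n False (Suc i) v) id"
  proof (cases "i \<in> {1..<n} \<and> Suc i \<in> {1..<n}")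
    case True
    have n: "act j id = sref j" for j by (simp add: act_def)
    have "act i (sref (Suc i)) = sref i \<circ> sref (Suc i) \<circ> sref i"
      "act (Suc i) (sref i) = sref (Suc i) \<circ> sref i \<circ> sref (Suc i)"
      by (auto simp: act_def sref_apply)
    moreover have "sref i \<circ> sref (Suc i) \<circ> sref i = sref (Suc i) \<circ> sref i \<circ> sref (Suc i)"
      using sref_braid by (simp add: fun_eq_iff)
    moreover have "act_coeff False i (sref (Suc i)) = 1" "act_coeff False (Suc i) (sref i) = 1" "act_coeff False j id = 1" for j
      by (auto simp: act_coeff_def sref_apply)
    moreover have "sref i \<in> inv_states n False" "sref (Suc i) \<in> inv_states n False"
      using True act_inv_states[OF id_inv_states] by (metis n)+
    ultimately show ?thesis using True id_inv_states[of n] by (simp add: gen_op_def n)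
  next
    case False
    then show ?thesis by (auto simp: gen_op_def)
  qed
  then show ?thesis by (simp only: exp_op_apply gen_op_exp_op) (simp add: algebra_simps)
qed

text \<open>\<open>one_fpf\<close> matches \<open>2k+1\<close> with \<open>2k+2\<close>, whence the
  vanishing. In the second relation both sides reach the nested matching of \<open>2k+1\<close> with
  \<open>2k+4\<close> and \<open>2k+2\<close> with \<open>2k+3\<close>.\<close>

lemma base_one_fpf:
  assumes "even n"
  shows "gen_op n True (2 * k + 1) v one_fpf = 0"
    and "gen_op n True (2 * k + 2) (gen_op n True (2 * k + 1) v) one_fpf =
      gen_op n True (2 * k + 2) (gen_op n True (2 * k + 3) v) one_fpf"
proof -
  note S = one_fpf_inv_states[OF assms]
  show "gen_op n True (2 * k + 1) v one_fpf = 0"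
    by (simp add: gen_op_def act_coeff_def one_fpf_def)
  show "gen_op n True (2 * k + 2) (gen_op n True (2 * k + 1) v) one_fpf =
      gen_op n True (2 * k + 2) (gen_op n True (2 * k + 3) v) one_fpf"
  proof (cases "2 * k + 2 < n")
    case True
    \<comment> \<open>Evenness of \<open>n\<close> ensures that the generator
      \<open>2 * k + 3\<close> is available whenever \<open>2 * k + 2\<close> is.\<close>
    then have r: "2 * k + 3 < n" using assms by presburger
    define u where "u = sref (2 * k + 2) \<circ> one_fpf \<circ> sref (2 * k + 2)"
    have u: "act (2 * k + 2) one_fpf = u"
      by (simp add: act_def one_fpf_def u_def)
    have uS: "u \<in> inv_states n True"
      using act_inv_states[OF S, of "2 * k + 2"] True u by simp
    have c: "act_coeff True (2 * k + 1) u = 1" "act_coeff True (2 * k + 3) u = 1"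
      by (simp_all add: act_coeff_def u_def sref_apply one_fpf_def)
    have n: "act (2 * k + 1) u = sref (2 * k + 1) \<circ> u \<circ> sref (2 * k + 1)"
      "act (2 * k + 3) u = sref (2 * k + 3) \<circ> u \<circ> sref (2 * k + 3)"
      by (auto simp: act_def u_def sref_apply one_fpf_def)
    have "sref (2 * k + 1) (u (sref (2 * k + 1) x)) = sref (2 * k + 3) (u (sref (2 * k + 3) x))" for x
      unfolding u_def sref_apply one_fpf_def o_apply by simp presburger
    then have "act (2 * k + 1) u = act (2 * k + 3) u" unfolding n by (simp add: fun_eq_iff)
    then show ?thesis using True r S uS c u by (simp add: gen_op_def)
  next
    case False
    then show ?thesis by (simp add: gen_op_def)
  qed
qed

section \<open>Cells in reading order\<close>

lemma foldr_concat_map: "foldr f (concat (map g xs)) v = foldr (\<lambda>x. foldr f (g x)) xs v"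
  by (induction xs) simp_all

text \<open>Serves both sides: a cell \<open>(i, j)\<close> is either the variable index
  \<open>i\<close> with the letter \<open>j\<close>, or a pipe dream position with the letter
  \<open>i + j - 1\<close>.\<close>

definition grid :: "nat \<Rightarrow> (nat \<Rightarrow> nat) \<Rightarrow> (nat \<Rightarrow> nat) \<Rightarrow> (nat \<times> nat) list" where
  "grid n lo hi = concat (map (\<lambda>i. map (Pair i) (rev [lo i..<hi i])) [1..<Suc n])"

lemma set_grid: "set (grid n lo hi) = {(i, j). i \<in> {1..n} \<and> lo i \<le> j \<and> j < hi i}"
  by (fastforce simp: grid_def simp del: upt_Suc)

lemma sorted_grid: "sorted_wrt prec (grid n lo hi)"
proof (induction n)
  case (Suc n)
  have "sorted_wrt prec (map (Pair i) (rev [lo i..<hi i]))" for i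
    using sorted_wrt_upt[of "lo i" "hi i"]
    by (auto simp: sorted_wrt_map sorted_wrt_rev prec_def)
  moreover have "grid (Suc n) lo hi = grid n lo hi @ map (Pair (Suc n)) (rev [lo (Suc n)..<hi (Suc n)])"
    by (simp add: grid_def)
  moreover have "prec p q" if "p \<in> set (grid n lo hi)" "q \<in> Pair (Suc n) ` S" for p q S
    using that by (auto simp: set_grid prec_def)
  ultimately show ?case using Suc by (auto simp: sorted_wrt_append)
qed (simp add: grid_def)

lemma sorted_prec_distinct: "sorted_wrt prec ps \<Longrightarrow> distinct ps"
  by (induction ps) (auto simp: prec_def)

lemma sorted_prec_unique:
  "sorted_wrt prec ps \<Longrightarrow> sorted_wrt prec qs \<Longrightarrow> set ps = set qs \<Longrightarrow> ps = qs"
  using ex1_prec_list[of "set ps"] by auto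

lemma filter_sorted_prec:
  assumes "sorted_wrt prec ps" "sorted_wrt prec qs" "set qs \<subseteq> set ps"
  shows "filter (\<lambda>p. p \<in> set qs) ps = qs"
  using assms by (intro sorted_prec_unique) (auto simp: sorted_wrt_filter)

lemma dream_word_eq:
  assumes "sorted_wrt prec ps" "D \<subseteq> set ps"
  shows "dream_word D = map (\<lambda>(i, j). i + j - 1) (filter (\<lambda>p. p \<in> D) ps)"
proof -
  have "finite D" using assms(2) finite_subset by auto
  then have "(THE ps. sorted_wrt prec ps \<and> set ps = D) = filter (\<lambda>p. p \<in> D) ps"
    using assms by (intro the1_equality ex1_prec_list) (auto simp: sorted_wrt_filter)
  then show ?thesis by (simp add: dream_word_def)
qed

lemma grid_identity:
  assumes "fpf \<Longrightarrow> even n"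
  shows "foldr (\<lambda>p. exp_op n fpf (snd p) (Xvar (fst p))) (grid n id (\<lambda>i. n)) v (if fpf then one_fpf else id) =
    foldr (\<lambda>p. exp_op n fpf (fst p + snd p - 1) (x_oplus (fst p) (snd p)))
      (grid n (\<lambda>i. 1) (\<lambda>i. if fpf then i else Suc i)) v (if fpf then one_fpf else id)"
proof -
  interpret yang_baxter n Beta "exp_op n fpf" by (rule yang_baxter_exp_op)
  let ?e = "if fpf then one_fpf else id"
  have "down (2 * k + 1) y v ?e = (if fpf then id else exp_op n fpf (2 * k + 1) y) (up (2 * k + 2) y v) ?e" for k y v
  proof (cases fpf)
    case True
    have "down (2 * k + 1) y v one_fpf = up (2 * k + 2) y v one_fpf"
    proof (rule base_fpf[where \<mu> = "\<lambda>v. v one_fpf"])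
      fix k y v
      show "exp_op n fpf (2 * k + 2) y (exp_op n fpf (2 * k + 1) y v) one_fpf =
          exp_op n fpf (2 * k + 2) y (exp_op n fpf (2 * k + 3) y v) one_fpf"
      proof -
        \<comment> \<open>Odd generators kill the base point, so after expansion only the quadratic
          terms have to be compared.\<close>
        have "gen_op n True (2 * k + 3) v one_fpf = 0"
          using base_one_fpf(1)[OF assms, OF True, of "Suc k" v] by (simp add: numeral_eq_Suc)
        then show ?thesis
          using base_one_fpf[OF assms, OF True, of k v] True by (simp add: exp_op_apply gen_op_exp_op)
      qed
    qed
    with True show ?thesis by simp
  next
    case False
    have "down (2 * k + 1) y v id = up (2 * k + 1) y v id"
      using base_id[of n] False by (intro base_involution[where \<mu> = "\<lambda>v. v id"]) simp
    with False show ?thesis using up_rec[of "2 * k + 1"] by simp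
  qed
  note eq = rows_eq_downs[where \<mu> = "\<lambda>v. v ?e", OF this, of Xvar v]
  have op: "(if i = j then Xvar i else oplus (Xvar i) (Xvar j)) = x_oplus i j" for i j
    by (simp add: x_oplus_def oplus_def)
  show ?thesis
    using eq unfolding rows_def row_def down_def op grid_def foldr_concat_map foldr_map o_def fst_conv snd_conv
    by (simp add: rev_map[symmetric] foldr_map o_def del: upt_Suc)
qed

theorem theorem4p5:
  fixes n :: nat and z :: perm
  assumes "n \<ge> 1"
    and "z \<in> Invol n \<or> even n \<and> z \<in> Invol_fpf n"
  shows "inv_groth n z =
    (\<Sum>D \<in> InvDreams n z. Beta ^ (card D - inv_len n z) * (\<Prod>(i, j) \<in> D. x_oplus i j))"
proof -
  define fpf where "fpf \<longleftrightarrow> z \<in> Invol_fpf n"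
  have z: "z \<in> Invol n \<and> \<not> fpf \<or> z \<in> Invol_fpf n \<and> even n \<and> fpf"
    using assms Invol_disjoint[of n] by (auto simp: fpf_def)
  let ?e = "if fpf then one_fpf else id"
  let ?\<delta> = "\<lambda>w. if w = z then 1 else 0 :: gpoly"
  let ?c = "\<lambda>a. if a \<in> InvHecke n z then Beta ^ (length a - inv_len n z) else 0"
  have letters: "set a \<subseteq> {1..n - 1}" if "a \<in> InvHecke n z" for a
    using that by (simp add: InvHecke_def)
  \<comment> \<open>Subsets of \<open>L\<close> encode words with a positive compatible sequence;
    subsets of \<open>G\<close> are the candidate pipe dreams.\<close>
  define L where "L = grid n id (\<lambda>i. n)"
  define G where "G = grid n (\<lambda>i. 1) (\<lambda>i. if fpf then i else Suc i)"
  have L: "sorted_wrt prec L" "set L = {(i, j). 1 \<le> i \<and> i \<le> j \<and> j < n}"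
    unfolding L_def by (auto simp: sorted_grid set_grid)
  have G: "sorted_wrt prec G" "set G = {(i, j). i \<le> n \<and> 1 \<le> j \<and> (if fpf then j < i else j \<le> i)}"
    unfolding G_def by (auto simp: sorted_grid set_grid)
  have filter_set: "set (filter (\<lambda>p. p \<in> D) ps) = D" if "D \<subseteq> set ps" for D and ps :: "(nat \<times> nat) list"
    using that by auto
  have dreams: "(\<Sum>D\<in>Pow (set G). (\<Prod>(i, j)\<in>D. x_oplus i j) * ?c (dream_word D)) =
      (\<Sum>D \<in> InvDreams n z. Beta ^ (card D - inv_len n z) * (\<Prod>(i, j) \<in> D. x_oplus i j))"
  proof (rule sum.mono_neutral_cong_right)
    show "InvDreams n z \<subseteq> Pow (set G)"
    proof (intro subsetI PowI)
      fix D p assume D: "D \<in> InvDreams n z" and p: "p \<in> D"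
      obtain i j where ij: "p = (i, j)" by force
      have fin: "finite D" using D by (simp add: InvDreams_def)
      have "set (THE ps. sorted_wrt prec ps \<and> set ps = D) = D"
        using theI'[OF ex1_prec_list[OF fin]] by blast
      then have "i + j - 1 \<in> set (dream_word D)"
        using p ij by (force simp: dream_word_def)
      moreover have "set (dream_word D) \<subseteq> {1..n - 1}"
        using D letters by (simp only: InvDreams_def mem_Collect_eq)
      \<comment> \<open>With \<open>n \<ge> 1\<close> and \<open>j > 0\<close> this gives
        \<open>i \<le> n\<close>, so the dream fits into the rows of \<open>G\<close>.\<close>
      ultimately have "i + j - 1 \<le> n - 1" by auto
      then show "p \<in> set G"
        using D p ij z assms(1) Invol_disjoint[of n] by (fastforce simp: InvDreams_def G)
    qed
    show "\<forall>D\<in>Pow (set G) - InvDreams n z. (\<Prod>(i, j)\<in>D. x_oplus i j) * ?c (dream_word D) = 0"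
    proof
      fix D assume D: "D \<in> Pow (set G) - InvDreams n z"
      then have "finite D" using finite_subset by auto
      then have "dream_word D \<notin> InvHecke n z"
        using D z by (auto simp: InvDreams_def G split: if_splits)
      then show "(\<Prod>(i, j)\<in>D. x_oplus i j) * ?c (dream_word D) = 0" by simp
    qed
    fix D assume D: "D \<in> InvDreams n z"
    then have "D \<subseteq> set G" using \<open>InvDreams n z \<subseteq> Pow (set G)\<close> by auto
    moreover from this have "{p \<in> set G. p \<in> D} = D" by auto
    ultimately have "length (dream_word D) = card D"
      using G(1) sorted_prec_distinct[OF G(1)]
      by (simp add: dream_word_eq distinct_card[symmetric])
    moreover have "dream_word D \<in> InvHecke n z" using D by (simp add: InvDreams_def)
    ultimately show "(\<Prod>(i, j)\<in>D. x_oplus i j) * ?c (dream_word D) =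
        Beta ^ (card D - inv_len n z) * (\<Prod>(i, j) \<in> D. x_oplus i j)"
      by simp
  qed simp
  let ?f = "\<lambda>D. filter (\<lambda>p. p \<in> D) L"
  have words: "(\<Sum>D\<in>Pow (set L). (\<Prod>p\<in>D. Xvar (fst p)) * ?c (map snd (?f D))) = inv_groth n z"
  proof -
    let ?P = "{D. D \<subseteq> set L \<and> map snd (?f D) \<in> InvHecke n z}"
    have "(\<Sum>D\<in>Pow (set L). (\<Prod>p\<in>D. Xvar (fst p)) * ?c (map snd (?f D))) =
        (\<Sum>D\<in>?P. (\<Prod>p\<in>D. Xvar (fst p)) * ?c (map snd (?f D)))"
      by (rule sum.mono_neutral_right) auto
    also have "\<dots> = inv_groth n z"
      unfolding inv_groth_def
    \<comment> \<open>For the pairs of an index and its letter, increasing in \<open>prec\<close>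
      means exactly weakly increasing indices that rise strictly wherever the letters do not fall.
      So a compatible pair is a subset of \<open>L\<close> read in order.\<close>
    proof (rule sum.reindex_bij_witness[where
          i = "\<lambda>(a, is). set (zip (map nat is) a)" and
          j = "\<lambda>D. (map snd (?f D), map (int \<circ> fst) (?f D))"])
      fix D assume "D \<in> ?P"
      then have D: "D \<subseteq> set L" "map snd (?f D) \<in> InvHecke n z" by auto
      have srt: "sorted_wrt prec (?f D)" using L(1) by (simp add: sorted_wrt_filter)
      have zip: "zip (map nat (map (int \<circ> fst) (?f D))) (map snd (?f D)) = ?f D"
        by (simp add: o_def zip_map_fst_snd)
      show "(case (map snd (?f D), map (int \<circ> fst) (?f D)) of (a, is) \<Rightarrow> set (zip (map nat is) a)) = D"
        using zip filter_set[OF D(1)] by simp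
      have mem: "?f D ! k \<in> set L" if "k < length (?f D)" for k
        using nth_mem[OF that] by auto
      have act: "prec (?f D ! k) (?f D ! l)" if "k < l" "l < length (?f D)" for k l
        using srt that by (simp add: sorted_wrt_nth_less)
      have "map (int \<circ> fst) (?f D) \<in> Compatible (map snd (?f D))"
        unfolding Compatible_def
      proof (intro CollectI conjI allI impI)
        show "sorted (map (int \<circ> fst) (?f D))"
          unfolding sorted_map using srt by (rule sorted_wrt_mono_rel[rotated]) (auto simp: prec_def)
        fix k assume "Suc k < length (map snd (?f D))" "map snd (?f D) ! k \<le> map snd (?f D) ! Suc k"
        then show "map (int \<circ> fst) (?f D) ! k < map (int \<circ> fst) (?f D) ! Suc k"
          using act[of k "Suc k"] by (auto simp: prec_def)
      next
        fix k assume "k < length (map snd (?f D))"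
        then show "map (int \<circ> fst) (?f D) ! k \<le> int (map snd (?f D) ! k)"
          using mem[of k] by (auto simp: L)
      qed simp
      moreover have "\<forall>i\<in>set (map (int \<circ> fst) (?f D)). 0 < i"
        by (auto simp: L)
      ultimately show "(map snd (?f D), map (int \<circ> fst) (?f D)) \<in> compatible_pairs n z"
        using D(2) by (simp add: compatible_pairs_def)
      have "(\<Prod>i\<leftarrow>map (int \<circ> fst) (?f D). Xvar (nat i)) = (\<Prod>p\<in>D. Xvar (fst p))"
        using prod.distinct_set_conv_list[OF sorted_prec_distinct[OF srt], of "Xvar \<circ> fst"] filter_set[OF D(1)]
        by (simp add: o_def)
      then show "(case (map snd (?f D), map (int \<circ> fst) (?f D)) of (a, is) \<Rightarrow>
          Beta ^ (length is - inv_len n z) * (\<Prod>i\<leftarrow>is. Xvar (nat i))) =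
          (\<Prod>p\<in>D. Xvar (fst p)) * ?c (map snd (?f D))"
        using D(2) by simp
    next
      fix ai assume "ai \<in> compatible_pairs n z"
      then obtain a "is" where ai: "ai = (a, is)" and a: "a \<in> InvHecke n z"
        and c: "is \<in> Compatible a" and pos: "\<forall>i\<in>set is. 0 < i"
        by (auto simp: compatible_pairs_def)
      define qs where "qs = zip (map nat is) a"
      have len: "length is = length a" using c by (simp add: Compatible_def)
      have nth: "qs ! k = (nat (is ! k), a ! k)" "0 < is ! k" "is ! k \<le> int (a ! k)" "a ! k < n"
        if "k < length a" for k
      proof -
        show "qs ! k = (nat (is ! k), a ! k)" using that len by (simp add: qs_def)
        show p: "0 < is ! k" using that len pos by simp
        then show "is ! k \<le> int (a ! k)" using c that by (simp add: Compatible_def)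
        have "a ! k \<in> {1..n - 1}" using letters[OF a] that nth_mem by blast
        then show "a ! k < n" by auto
      qed
      have srt: "sorted_wrt prec qs"
      proof -
        have "transp prec" by (auto simp: transp_def prec_def)
        moreover have "prec (qs ! k) (qs ! Suc k)" if k: "Suc k < length qs" for k
        proof -
          have k': "Suc k < length a" using k len by (simp add: qs_def)
          have "is ! k \<le> is ! Suc k" using c k' by (simp add: Compatible_def sorted_nth_mono)
          moreover have "a ! k \<le> a ! Suc k \<Longrightarrow> is ! k < is ! Suc k" using c k' by (simp add: Compatible_def)
          ultimately show ?thesis
            using nth[of k] nth[of "Suc k"] k'
            by (cases "a ! k \<le> a ! Suc k") (auto simp: prec_def)
        qed
        ultimately show ?thesis by (simp add: sorted_wrt_iff_nth_Suc_transp)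
      qed
      have sub: "set qs \<subseteq> set L"
      proof
        fix q assume "q \<in> set qs"
        then obtain k where "k < length a" "q = qs ! k" using len by (auto simp: in_set_conv_nth qs_def)
        then show "q \<in> set L" using nth[of k] by (auto simp: L)
      qed
      have f: "?f (set qs) = qs" by (rule filter_sorted_prec[OF L(1) srt sub])
      have "map int (map nat is) = is" using pos by (induction "is") auto
      then have "map snd qs = a" "map (int \<circ> fst) qs = is"
        using len by (auto simp: qs_def map_fst_zip simp flip: map_map)
      then show "(\<lambda>D. (map snd (?f D), map (int \<circ> fst) (?f D))) (case ai of (a, is) \<Rightarrow> set (zip (map nat is) a)) = ai"
        "(case ai of (a, is) \<Rightarrow> set (zip (map nat is) a)) \<in> ?P"
        using f sub a by (auto simp: ai qs_def)
    qed
    finally show ?thesis .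
  qed
  \<comment> \<open>Both sums are expansions of operator products applied to the coordinate
    functional of \<open>z\<close> and evaluated at the base point.\<close>
  have "inv_groth n z = foldr (\<lambda>p. exp_op n fpf (snd p) (Xvar (fst p))) L ?\<delta> ?e"
    unfolding words[symmetric] foldr_exp_op_expand[OF sorted_prec_distinct[OF L(1)]]
      foldr_gen_op_InvHecke[OF z] ..
  also have "\<dots> = foldr (\<lambda>p. exp_op n fpf (fst p + snd p - 1) (x_oplus (fst p) (snd p))) G ?\<delta> ?e"
    unfolding L_def G_def by (rule grid_identity) (use z in auto)
  also have "\<dots> = (\<Sum>D\<in>Pow (set G). (\<Prod>(i, j)\<in>D. x_oplus i j) * ?c (dream_word D))"
    unfolding foldr_exp_op_expand[OF sorted_prec_distinct[OF G(1)]] foldr_gen_op_InvHecke[OF z]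
    by (rule sum.cong) (simp_all add: dream_word_eq[OF G(1)] case_prod_unfold)
  finally show ?thesis using dreams by simp
qed

end
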